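(* Let $a\in(0,1]$ and let $f$ be an area-preserving pseudo-rotation of $\mathbb{T}^2$ that is H\"older with exponent $a$, with $\rho(f)=\omega \bmod \mathbb{Z}^2$, where $\omega\in\mathbb{R}^2$ is irrational and satisfies $$\liminf_{n\to+\infty} n^{-1}a^{n}\ln\|n\omega\|_{\mathbb{T}^2}=-\infty .$$ Suppose that one of the following conditions holds: (1) $f$ has bounded mean motion; (2) $\omega$ is semi-irrational and there is an integer $\ell\ge 1$ such that $f^{\ell}$ has bounded deviation parallel to a character vector of $\omega$. Then $f$ is $C^0$-rigid, i.e. $\liminf_{n\to\infty} d_{C^0}(f^{n},\mathrm{Id}_{\mathbb{T}^2})=0$.
   Context: $\mathbb{T}^2=\mathbb{R}^2/\mathbb{Z}^2$, $\pi:\mathbb{R}^2\to\mathbb{T}^2$ is the covering projection, and $\mathrm{Homeo}_*(\mathbb{T}^2)$ is the group of homeomorphisms of $\mathbb{T}^2$ isotopic to the identity. A lift of $f\in\mathrm{Homeo}_*(\mathbb{T}^2)$ is a homeomorphism $\tilde f$ of $\mathbb{R}^2$ with $\pi\tilde f=f\pi$. The rotation set of $\tilde f$ is $$\rho(\tilde f)=\Big\{\mathbf v\in\mathbb{R}^2 \;\Big|\; \tfrac{\tilde f^{n_i}(z_i)-z_i}{n_i}\to\mathbf v \text{ for some } z_i\in\mathbb{R}^2,\ n_i\in\mathbb{N},\ n_i\to\infty\Big\}.$$ $f\in\mathrm{Homeo}_*(\mathbb{T}^2)$ is a pseudo-rotation if $\rho(\tilde f)$ is a single point; then $\rho(\tilde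 f)$ denotes that vector and $\rho(f)=\rho(\tilde f)\bmod\mathbb{Z}^2$. Area-preserving means preserving Lebesgue measure on $\mathbb{T}^2$. A vector $\omega=(\omega_1,\omega_2)\in\mathbb{R}^2$ is irrational if $\omega\notin\mathbb{Q}^2$; totally irrational if $\omega_1,\omega_2,1$ are linearly independent over $\mathbb{Q}$; semi-irrational if it is irrational but not totally irrational. If $\omega$ is semi-irrational there is $(c,d)\in\mathbb{Z}^2\setminus\{(0,0)\}$, unique up to sign, with $\gcd(c,d)=1$ and $c\omega_1+d\omega_2\in\mathbb{Q}$; the vectors $\pm(d,-c)$ are the character vectors of $\omega$. $\|\omega\|_{\mathbb{T}^2}=\min_{z\in\mathbb{Z}^2}\|\omega-z\|$, with $\|\cdot\|$ the Euclidean norm. For $v=(v_1,v_2)\in\mathbb{R}^2\setminus\{(0,0)\}$, $v^{\perp}=(-v_2,v_1)/\|v\|$. A pseudo-rotation $f$ has bounded mean motion if there are $\kappa\ge0$ and a lift $\tilde f$ with $\|\tilde f^n(z)-z-n\rho(\tilde f)\|\le\kappa$ for all $z\in\mathbb{R}^2$, $n\in\mathbb{N}$. It has bounded deviation parallel to $v\in\mathbb{R}^2\setminus\{(0,0)\}$ if there are $\kappa\ge 0$ and a lift $\tilde f$ with $|\langle\tilde f^n(z)-z-n\rho(\tilde f),v^{\perp}\rangle|\le\kappa$ for all $z\in\mathbb{R}^2$, $n\in\mathbb{N}$. (These quantities do not depend on the lift.) $d_{C^0}$ is the uniform distance: $d_{C^0}(f,g)=\sup_x d(f(x),g(x))$.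 *)

theory Defs
  imports "HOL-Analysis.Analysis"
begin

section \<open>The torus\<close>

type_synonym plane = "real \<times> real"

definition lattice :: "plane set" where
  "lattice = \<int> \<times> \<int>"

lemma lattice_closed_under:
  "0 \<in> lattice"
  "u \<in> lattice \<Longrightarrow> - u \<in> lattice"
  "u \<in> lattice \<Longrightarrow> v \<in> lattice \<Longrightarrow> u + v \<in> lattice"
  "u \<in> lattice \<Longrightarrow> v \<in> lattice \<Longrightarrow> u - v \<in> lattice"
  by (auto simp: lattice_def zero_prod_def mem_Times_iff)

lemma closed_lattice: "closed lattice"
  unfolding lattice_def by (intro closed_Times closed_Ints)

text \<open>The distance to the lattice, i.e. the norm \<open>\<parallel>v\<parallel>\<close> on the torus; the infimum
  is a minimum by \<open>torus_norm_attained\<close> below.\<close>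

definition torus_norm :: "plane \<Rightarrow> real" where
  "torus_norm v = (INF z\<in>lattice. norm (v - z))"

lemma torus_norm_infdist: "torus_norm v = infdist v lattice"
  using lattice_closed_under(1) by (auto simp: torus_norm_def infdist_def dist_norm)

lemma torus_norm_attained:
  obtains z where "z \<in> lattice" "torus_norm v = norm (v - z)"
  using infdist_attains_inf[OF closed_lattice] lattice_closed_under(1)
  by (metis dist_norm empty_iff torus_norm_infdist)

lemma torus_norm_le: "z \<in> lattice \<Longrightarrow> torus_norm v \<le> norm (v - z)"
  by (simp add: torus_norm_infdist infdist_le flip: dist_norm)

lemma torus_norm_nonneg: "0 \<le> torus_norm v"
  by (simp add: torus_norm_infdist infdist_nonneg)

lemma torus_norm_eq_0_iff: "torus_norm v = 0 \<longleftrightarrow> v \<in> lattice"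
  using in_closed_iff_infdist_zero[OF closed_lattice] lattice_closed_under(1)
  by (metis empty_iff torus_norm_infdist)

lemma torus_norm_minus: "torus_norm (- v) = torus_norm v"
proof -
  have "torus_norm (- v) \<le> torus_norm v" for v
  proof -
    obtain z where z: "z \<in> lattice" "torus_norm v = norm (v - z)"
      by (rule torus_norm_attained)
    have "torus_norm (- v) \<le> norm (- v - (- z))"
      by (intro torus_norm_le lattice_closed_under z)
    also have "\<dots> = norm (v - z)"
      by (metis minus_diff_minus norm_minus_cancel)
    finally show ?thesis using z by simp
  qed
  from this[of v] this[of "- v"] show ?thesis by simp
qed

lemma torus_norm_triangle: "torus_norm (u + v) \<le> torus_norm u + torus_norm v"
proof -
  obtain z where z: "z \<in> lattice" "torus_norm u = norm (u - z)" by (rule torus_norm_attained)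
  obtain w where w: "w \<in> lattice" "torus_norm v = norm (v - w)" by (rule torus_norm_attained)
  have "torus_norm (u + v) \<le> norm (u + v - (z + w))"
    by (intro torus_norm_le lattice_closed_under z w)
  also have "\<dots> = norm ((u - z) + (v - w))" by (simp add: algebra_simps)
  also have "\<dots> \<le> norm (u - z) + norm (v - w)" by (rule norm_triangle_ineq)
  finally show ?thesis using z w by simp
qed

lemma torus_norm_add_lattice:
  assumes "z \<in> lattice" shows "torus_norm (v + z) = torus_norm v"
proof (rule antisym)
  have "torus_norm z = 0" "torus_norm (- z) = 0"
    using assms by (auto simp: torus_norm_eq_0_iff lattice_closed_under)
  then show "torus_norm (v + z) \<le> torus_norm v" "torus_norm v \<le> torus_norm (v + z)"
    using torus_norm_triangle[of v z] torus_norm_triangle[of "v + z" "- z"] by auto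
qed

quotient_type torus = plane / "\<lambda>u v. u - v \<in> lattice"
  morphisms rep_torus proj
proof (rule equivpI)
  show "reflp (\<lambda>u v. u - v \<in> lattice)"
    by (rule reflpI) (simp add: lattice_closed_under)
  show "symp (\<lambda>u v. u - v \<in> lattice)"
  proof (rule sympI)
    fix x y :: plane assume "x - y \<in> lattice"
    from lattice_closed_under(2)[OF this] show "y - x \<in> lattice" by simp
  qed
  show "transp (\<lambda>u v. u - v \<in> lattice)"
  proof (rule transpI)
    fix x y z :: plane assume "x - y \<in> lattice" "y - z \<in> lattice"
    from lattice_closed_under(3)[OF this] show "x - z \<in> lattice" by simp
  qed
qed

lemma proj_eq_iff: "proj u = proj v \<longleftrightarrow> u - v \<in> lattice"
  by (rule torus.abs_eq_iff)

lemma proj_surj: obtains u where "proj u = x"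
  by (metis Quotient3_abs_rep Quotient3_torus)

instantiation torus :: metric_space
begin

lift_definition dist_torus :: "torus \<Rightarrow> torus \<Rightarrow> real" is "\<lambda>u v. torus_norm (u - v)"
proof -
  fix u u' v v' :: plane
  assume "u - u' \<in> lattice" "v - v' \<in> lattice"
  then have "(u - u') - (v - v') \<in> lattice" by (rule lattice_closed_under)
  from torus_norm_add_lattice[OF this, of "u' - v'"]
  show "torus_norm (u - v) = torus_norm (u' - v')" by (simp add: algebra_simps)
qed

definition uniformity_torus :: "(torus \<times> torus) filter" where
  "uniformity_torus = (INF e\<in>{0<..}. principal {(x, y). dist x y < e})"

definition open_torus :: "torus set \<Rightarrow> bool" where
  "open_torus U \<longleftrightarrow> (\<forall>x\<in>U. \<forall>\<^sub>F (x', y) in uniformity. x' = x \<longrightarrow> y \<in> U)"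

instance
proof
  show "uniformity = (INF e\<in>{0<..}. principal {(x, y::torus). dist x y < e})"
    by (rule uniformity_torus_def)
  fix x y z :: torus
  show "dist x y = 0 \<longleftrightarrow> x = y"
    by transfer (rule torus_norm_eq_0_iff)
  show "dist x y \<le> dist x z + dist y z"
  proof transfer
    fix x y z :: plane
    have "torus_norm (x - y) = torus_norm ((x - z) + - (y - z))" by (simp add: algebra_simps)
    also have "\<dots> \<le> torus_norm (x - z) + torus_norm (y - z)"
      using torus_norm_triangle[of "x - z" "- (y - z)"] unfolding torus_norm_minus .
    finally show "torus_norm (x - y) \<le> torus_norm (x - z) + torus_norm (y - z)" .
  qed
qed (rule open_torus_def)

end

lemma dist_proj: "dist (proj u) (proj v) = torus_norm (u - v)"
  by (rule dist_torus.abs_eq)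

lemma dist_proj_le: "dist (proj u) (proj v) \<le> dist u v"
  using torus_norm_le[OF lattice_closed_under(1), of "u - v"] by (simp add: dist_proj dist_norm)

lemma continuous_on_proj: "continuous_on A proj"
  unfolding continuous_on_iff using dist_proj_le by (meson le_less_trans)

text \<open>The metric induces the quotient topology.\<close>

lemma open_torus_iff: "open U \<longleftrightarrow> open (proj -` U)"
proof
  assume "open U" then show "open (proj -` U)"
    using continuous_on_proj by (rule open_vimage)
next
  assume V: "open (proj -` U)"
  show "open U"
    unfolding open_dist
  proof
    fix x assume "x \<in> U"
    obtain u where u: "proj u = x" by (rule proj_surj)
    then have "u \<in> proj -` U" using \<open>x \<in> U\<close> by simp
    from V[unfolded open_dist, rule_format, OF this]
    obtain e where e: "e > 0" "\<And>w. dist w u < e \<Longrightarrow> proj w \<in> U"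
      by blast
    have "y \<in> U" if "dist y x < e" for y
    proof -
      obtain w where w: "proj w = y" by (rule proj_surj)
      obtain z where z: "z \<in> lattice" "torus_norm (w - u) = norm (w - u - z)"
        by (rule torus_norm_attained)
      have "dist (w - z) u < e"
      proof -
        have "torus_norm (w - u) < e"
          using that by (simp add: dist_proj flip: u w)
        moreover have "w - u - z = w - z - u" by simp
        ultimately show ?thesis using z(2) by (simp add: dist_norm)
      qed
      then have "proj (w - z) \<in> U" by (rule e)
      moreover have "proj (w - z) = y"
        using z by (auto simp: proj_eq_iff lattice_closed_under simp flip: w)
      ultimately show ?thesis by simp
    qed
    with e show "\<exists>e>0. \<forall>y. dist y x < e \<longrightarrow> y \<in> U" by blast
  qed
qed

lemma torus_norm_le_2: "torus_norm v \<le> 2"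
proof -
  define z where "z = (real_of_int \<lfloor>fst v\<rfloor>, real_of_int \<lfloor>snd v\<rfloor>)"
  have "torus_norm v \<le> norm (v - z)"
    by (rule torus_norm_le) (auto simp: z_def lattice_def)
  also have "v - z = (frac (fst v), frac (snd v))"
    by (simp add: z_def frac_def prod_eq_iff)
  also have "norm \<dots> \<le> norm (frac (fst v)) + norm (frac (snd v))"
    by (rule norm_Pair_le)
  also have "\<dots> \<le> 2"
    using frac_lt_1[of "fst v"] frac_lt_1[of "snd v"] by simp
  finally show ?thesis .
qed

lemma dist_torus_le_2: "dist x (y::torus) \<le> 2"
  by transfer (rule torus_norm_le_2)

definition torus_lebesgue :: "torus measure" where
  "torus_lebesgue = distr (restrict_space lborel ({0..<1} \<times> {0..<1})) borel proj"

lemma emeasure_torus_lebesgue: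
  assumes "A \<in> sets borel"
  shows "emeasure torus_lebesgue A = emeasure lborel (proj -` A \<inter> {0..<1} \<times> {0..<1})"
proof -
  have Q: "({0..<1} \<times> {0..<1} :: plane set) \<in> sets borel"
    by (intro borel_Times) auto
  have m: "proj \<in> borel_measurable (restrict_space lborel ({0..<1} \<times> {0..<1}))"
    by (intro measurable_restrict_space1) (simp add: borel_measurable_continuous_onI continuous_on_proj)
  show ?thesis
    using Q by (simp add: torus_lebesgue_def emeasure_distr[OF m assms] emeasure_restrict_space
        space_restrict_space Int_absorb2)
qed

section \<open>Homeomorphisms, lifts and rotation sets\<close>

definition homeo :: "('a::topological_space \<Rightarrow> 'a) \<Rightarrow> bool" where
  "homeo f \<longleftrightarrow> (\<exists>g. homeomorphism UNIV UNIV f g)"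

definition Homeo0 :: "(torus \<Rightarrow> torus) set" where
  "Homeo0 = {f. homeo f \<and> homotopic_with_canon homeo UNIV UNIV id f}"

definition is_lift :: "(plane \<Rightarrow> plane) \<Rightarrow> (torus \<Rightarrow> torus) \<Rightarrow> bool" where
  "is_lift F f \<longleftrightarrow> homeo F \<and> (\<forall>z. proj (F z) = f (proj z))"

definition rotation_set :: "(plane \<Rightarrow> plane) \<Rightarrow> plane set" where
  "rotation_set F =
     {v. \<exists>(z :: nat \<Rightarrow> plane) (n :: nat \<Rightarrow> nat). filterlim n at_top sequentially \<and>
           (\<lambda>i. ((F ^^ n i) (z i) - z i) /\<^sub>R real (n i)) \<longlonglongrightarrow> v}"

definition pseudo_rotation :: "(torus \<Rightarrow> torus) \<Rightarrow> bool" where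
  "pseudo_rotation f \<longleftrightarrow> f \<in> Homeo0 \<and> (\<exists>F v. is_lift F f \<and> rotation_set F = {v})"

text \<open>The next two notions are meaningful for (lifts of) pseudo-rotations. Two lifts of a
  pseudo-rotation differ by a lattice translation, so the choice of a lift in
  \<open>rotation_number\<close> is immaterial.\<close>

definition rotation_vector :: "(plane \<Rightarrow> plane) \<Rightarrow> plane" where
  "rotation_vector F = the_elem (rotation_set F)"

definition rotation_number :: "(torus \<Rightarrow> torus) \<Rightarrow> torus" where
  "rotation_number f = proj (rotation_vector (SOME F. is_lift F f))"

definition area_preserving :: "(torus \<Rightarrow> torus) \<Rightarrow> bool" where
  "area_preserving f \<longleftrightarrow>
     f \<in> measurable torus_lebesgue torus_lebesgue \<and>
     distr torus_lebesgue torus_lebesgue f = torus_lebesgue"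

definition holder :: "real \<Rightarrow> ('a::metric_space \<Rightarrow> 'b::metric_space) \<Rightarrow> bool" where
  "holder a f \<longleftrightarrow> (\<exists>C. \<forall>x y. dist (f x) (f y) \<le> C * dist x y powr a)"

section \<open>Arithmetic of rotation vectors\<close>

definition irrational :: "plane \<Rightarrow> bool" where
  "irrational \<omega> \<longleftrightarrow> \<omega> \<notin> \<rat> \<times> \<rat>"

definition totally_irrational :: "plane \<Rightarrow> bool" where
  "totally_irrational \<omega> \<longleftrightarrow>
     (\<forall>p q r :: rat. of_rat p * fst \<omega> + of_rat q * snd \<omega> + of_rat r * 1 = 0
        \<longrightarrow> p = 0 \<and> q = 0 \<and> r = 0)"

definition semi_irrational :: "plane \<Rightarrow> bool" where
  "semi_irrational \<omega> \<longleftrightarrow> irrational \<omega> \<and> \<not> totally_irrational \<omega>"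

text \<open>Both signs are covered, since \<open>(c, d)\<close> may be replaced by \<open>(- c, - d)\<close>.\<close>

definition character_vector :: "plane \<Rightarrow> plane \<Rightarrow> bool" where
  "character_vector \<omega> v \<longleftrightarrow>
     (\<exists>c d :: int. (c, d) \<noteq> (0, 0) \<and> gcd c d = 1 \<and>
        of_int c * fst \<omega> + of_int d * snd \<omega> \<in> \<rat> \<and> v = (of_int d, - of_int c))"

section \<open>Bounded deviations and the uniform distance\<close>

definition perp :: "plane \<Rightarrow> plane" where
  "perp v = (- snd v, fst v) /\<^sub>R norm v"

definition bounded_mean_motion :: "(torus \<Rightarrow> torus) \<Rightarrow> bool" where
  "bounded_mean_motion f \<longleftrightarrow>
     (\<exists>\<kappa>\<ge>0. \<exists>F. is_lift F f \<and>
        (\<forall>z n. norm ((F ^^ n) z - z - real n *\<^sub>R rotation_vector F) \<le> \<kappa>))"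

definition bounded_deviation :: "(torus \<Rightarrow> torus) \<Rightarrow> plane \<Rightarrow> bool" where
  "bounded_deviation f v \<longleftrightarrow>
     (\<exists>\<kappa>\<ge>0. \<exists>F. is_lift F f \<and>
        (\<forall>z n. \<bar>((F ^^ n) z - z - real n *\<^sub>R rotation_vector F) \<bullet> perp v\<bar> \<le> \<kappa>))"

text \<open>The supremum is over a bounded set by \<open>dist_torus_le_2\<close>.\<close>

definition dist_C0 :: "(torus \<Rightarrow> torus) \<Rightarrow> (torus \<Rightarrow> torus) \<Rightarrow> real" where
  "dist_C0 f g = (SUP x. dist (f x) (g x))"

definition C0_rigid :: "(torus \<Rightarrow> torus) \<Rightarrow> bool" where
  "C0_rigid f \<longleftrightarrow> liminf (\<lambda>n. ereal (dist_C0 (f ^^ n) id)) = 0"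

end

theory Submission
  imports Defs
begin

text \<open>Suppose that \<open>f\<^sup>q\<close> is not close to the identity at a time \<open>q\<close> provided by the arithmetic
  condition. By Hoelder continuity there is a disc of radius \<open>r\<close>, with \<open>- ln r\<close> of order at most
  \<open>q a\<^bsup>-q\<^esup>\<close>, that is free (disjoint from its image) for the lift \<open>G = F\<^sup>q - p\<close>, while
  \<open>\<delta> = \<parallel>q \<omega> - p\<parallel>\<close> is positive but much smaller than \<open>r\<^sup>2\<close>. Since \<open>f\<close> preserves area, some
  orbit of \<open>f\<^sup>q\<close> visits the disc at least \<open>J r\<^sup>2 / 16\<close> times before time \<open>J\<close>. The bound on the deviations leaves
  fewer than \<open>C \<delta> J\<close> lattice translates of the disc that the lifted orbit can meet, so it
  meets one of them twice: a free disc returns to itself under \<open>G\<close>. By Brouwer's lemma, in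
  the form of Franks, \<open>G\<close> has a fixed point, which forces \<open>q \<omega> = p\<close>.\<close>

section \<open>Brouwer's lemma on periodic points\<close>

text \<open>Brouwer's lemma fails for orientation-reversing maps, so the isotopy to the identity has
  to enter. It enters once, as a continuous logarithm of the slopes
  \<open>(h q - h p) / (q - p)\<close>. This datum passes to compositions, inverses and translates
  by simple formulas, so it survives both the modification of \<open>h\<close> inside a disc and the
  passage from \<open>F\<close> to \<open>G\<close>. The counting compares two rates of growth in
  \<open>J\<close>. Additive errors may depend on \<open>q\<close>, since \<open>J\<close> is chosen
  after them; only the rate must be uniform in \<open>q\<close>. Under bounded mean motion a horizon
  of about \<open>1 / \<delta>\<close> suffices. In the semi-irrational case only one direction is
  controlled, and uniqueness of the rotation vector supplies a sublinear bound in the other.\<close>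

lemma continuous_exp_eq_imp_diff_const:
  fixes g1 g2 :: "'a::topological_space \<Rightarrow> complex"
  assumes "connected S" "continuous_on S g1" "continuous_on S g2"
    and "\<And>x. x \<in> S \<Longrightarrow> exp (g1 x) = exp (g2 x)"
  obtains k where "\<And>x. x \<in> S \<Longrightarrow> g1 x = g2 x + k"
proof -
  have "(\<lambda>x. g1 x - g2 x) constant_on S"
  proof (rule continuous_discrete_range_constant[OF assms(1)])
    show "continuous_on S (\<lambda>x. g1 x - g2 x)" by (intro continuous_intros assms)
    fix x assume x: "x \<in> S"
    \<comment> \<open>Two logarithms of one number differ by an integer multiple of
      \<open>2 * pi * \<i>\<close>, so distinct values of the difference are at least
      \<open>2 * pi\<close> apart.\<close>
    have "2 * pi \<le> norm ((g1 y - g2 y) - (g1 x - g2 x))"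
      if y: "y \<in> S" and ne: "g1 y - g2 y \<noteq> g1 x - g2 x" for y
    proof -
      obtain m :: int where m: "g1 x - g2 x = of_int (2 * m) * pi * \<i>"
        using assms(4)[OF x] by (auto simp: exp_eq algebra_simps)
      obtain n :: int where n: "g1 y - g2 y = of_int (2 * n) * pi * \<i>"
        using assms(4)[OF y] by (auto simp: exp_eq algebra_simps)
      have "n \<noteq> m" using ne m n by auto
      then have "1 \<le> \<bar>real_of_int (n - m)\<bar>" by linarith
      moreover have "(g1 y - g2 y) - (g1 x - g2 x) = of_int (n - m) * (2 * pi * \<i>)"
        unfolding m n by (simp add: algebra_simps)
      then have "norm ((g1 y - g2 y) - (g1 x - g2 x)) = \<bar>real_of_int (n - m)\<bar> * (2 * pi)"
        by (simp only: norm_mult norm_of_int) simp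
      ultimately show ?thesis
        by (simp only:) (use mult_right_mono[of 1 "\<bar>real_of_int (n - m)\<bar>" "2 * pi"] in simp)
    qed
    then show "\<exists>e>0. \<forall>y. y \<in> S \<and> g1 y - g2 y \<noteq> g1 x - g2 x
        \<longrightarrow> e \<le> norm ((g1 y - g2 y) - (g1 x - g2 x))"
      by (intro exI[of _ "2 * pi"]) auto
  qed
  then obtain k where "\<And>x. x \<in> S \<Longrightarrow> g1 x - g2 x = k" by (auto simp: constant_on_def)
  then show ?thesis by (intro that[of k]) (metis add.commute diff_add_cancel)
qed

text \<open>The existence of a continuous logarithm \<open>R\<close> of the secant slopes serves as a substitute for
  being isotopic to the identity.\<close>

definition secant_log :: "(complex \<Rightarrow> complex) \<Rightarrow> (complex \<times> complex \<Rightarrow> complex) \<Rightarrow> bool" where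
  "secant_log h R \<longleftrightarrow> continuous_on UNIV h \<and> continuous_on {(p, q). p \<noteq> q} R \<and>
     (\<forall>p q. p \<noteq> q \<longrightarrow> h q - h p = (q - p) * exp (R (p, q)))"

lemma secant_log_inj: "secant_log h R \<Longrightarrow> inj h"
proof (rule injI, rule ccontr)
  fix p q assume "secant_log h R" "h p = h q" "p \<noteq> q"
  then have "(q - p) * exp (R (p, q)) = 0"
    by (metis secant_log_def diff_self)
  with \<open>p \<noteq> q\<close> show False by simp
qed

text \<open>A half turn of the pair about its midpoint carries \<open>(p, q)\<close> to
  \<open>(q, p)\<close>. Along it, \<open>R\<close> and its swap are logarithms of the same slope,
  hence differ by a constant \<open>k\<close>; comparing the two ends of the path gives
  \<open>k = - k\<close>.\<close>

lemma secant_log_sym: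
  assumes "secant_log h R" "p \<noteq> q"
  shows "R (q, p) = R (p, q)"
proof -
  define \<gamma> where "\<gamma> t = ((p + q) / 2 - exp (\<i> * t) * (q - p) / 2, (p + q) / 2 + exp (\<i> * t) * (q - p) / 2)"
    for t :: real
  have cg: "continuous_on A \<gamma>" for A unfolding \<gamma>_def by (intro continuous_intros) auto
  have ne: "fst (\<gamma> t) \<noteq> snd (\<gamma> t)" for t
  proof
    assume "fst (\<gamma> t) = snd (\<gamma> t)"
    then have "exp (\<i> * t) * (q - p) = 0" by (simp add: \<gamma>_def)
    with assms show False by auto
  qed
  have ne': "\<gamma> t \<noteq> (u, u)" for t u
    using ne[of t] by auto
  have cR: "continuous_on {(p, q). p \<noteq> q} R" using assms by (simp add: secant_log_def)
  have cs: "continuous_on {0..pi} (\<lambda>t. R (prod.swap (\<gamma> t)))"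
    by (rule continuous_on_compose2[OF cR])
       (use cg ne' in \<open>auto intro!: continuous_intros simp: prod.swap_def split_beta prod_eq_iff\<close>)
  have c: "continuous_on {0..pi} (\<lambda>t. R (\<gamma> t))"
    by (rule continuous_on_compose2[OF cR]) (use cg ne' in \<open>auto intro!: continuous_intros, metis\<close>)
  have e: "exp (R (prod.swap (\<gamma> t))) = exp (R (\<gamma> t))" for t
  proof -
    obtain u v where uv: "\<gamma> t = (u, v)" by fastforce
    with ne[of t] have "u \<noteq> v" by auto
    with assms have "h v - h u = (v - u) * exp (R (u, v))" "h u - h v = (u - v) * exp (R (v, u))"
      by (auto simp: secant_log_def)
    then have "(v - u) * exp (R (u, v)) = (v - u) * exp (R (v, u))" by (metis minus_diff_eq minus_mult_left)
    with \<open>u \<noteq> v\<close> uv show ?thesis by simp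
  qed
  obtain k where k: "\<And>t. t \<in> {0..pi} \<Longrightarrow> R (prod.swap (\<gamma> t)) = R (\<gamma> t) + k"
    by (rule continuous_exp_eq_imp_diff_const[OF _ cs c e]) auto
  have "\<gamma> 0 = (p, q)" "\<gamma> pi = (q, p)" by (auto simp: \<gamma>_def field_simps)
  then show ?thesis using k[of 0] k[of pi] by simp
qed

text \<open>The argument of \<^term>\<open>c b - c a\<close> is tracked on the strip \<open>a < b < a + L\<close>. Going once
  around the closed curve \<open>c\<close> changes it by \<open>2 k\<close>, where \<open>k\<close> is the change under
  interchanging the two points, an odd multiple of \<open>\<pi>\<close>. But along \<open>b = a + 1\<close> it is
  the argument of the nonvanishing displacement of \<open>h\<close>, which does not change.\<close>

lemma no_closed_translation_path:
  assumes sl: "secant_log h R" and nofix: "\<And>z. h z \<noteq> z"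
    and cc: "continuous_on {0..} c" and ch: "\<And>t. 0 \<le> t \<Longrightarrow> c (t + 1) = h (c t)"
    and L: "1 < L" "c L = c (0::real)"
    and inj: "\<And>a b. 0 \<le> a \<Longrightarrow> a < b \<Longrightarrow> b < a + L \<Longrightarrow> c a \<noteq> c b"
  shows False
proof -
  \<comment> \<open>Convexity of the strip makes one single-valued logarithm \<open>T\<close> of
    \<open>c b - c a\<close> available on all of it.\<close>
  define \<Delta> where "\<Delta> = {(a, b). 0 \<le> a \<and> a < b \<and> b < a + L}"
  have "convex \<Delta>"
  proof -
    have "\<Delta> = ({x. (1, 0) \<bullet> x \<ge> 0} \<inter> {x. (1, -1) \<bullet> x < 0}) \<inter> {x. (-1, 1) \<bullet> x < L}"
      by (auto simp: \<Delta>_def)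
    then show ?thesis
      by (simp only:) (intro convex_Int convex_halfspace_ge convex_halfspace_lt)
  qed
  have "continuous_on \<Delta> (\<lambda>x. c (snd x) - c (fst x))"
    by (intro continuous_on_diff continuous_on_compose2[OF cc] continuous_intros) (auto simp: \<Delta>_def)
  then obtain T where T: "continuous_on \<Delta> T" "\<And>x. x \<in> \<Delta> \<Longrightarrow> c (snd x) - c (fst x) = exp (T x)"
    by (rule continuous_logarithm_on_contractible[OF _ convex_imp_contractible[OF \<open>convex \<Delta>\<close>]])
       (use inj in \<open>force simp: \<Delta>_def\<close>, blast)
  have ch': "continuous_on A h" for A
    using sl by (auto simp: secant_log_def intro: continuous_on_subset)
  obtain G where G: "continuous_on UNIV G" "\<And>z. h z - z = exp (G z)"
    by (rule continuous_logarithm_on_contractible[of UNIV "\<lambda>z. h z - z"])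
       (use nofix that in \<open>auto intro!: continuous_intros ch' convex_imp_contractible\<close>)
  have cTp: "continuous_on A (\<lambda>x. T (u x, v x))"
    if "continuous_on A u" "continuous_on A v" "\<And>x. x \<in> A \<Longrightarrow> (u x, v x) \<in> \<Delta>"
    for u v and A :: "'x::topological_space set"
    by (rule continuous_on_compose2[OF T(1)]) (use that in \<open>auto intro!: continuous_intros\<close>)
  \<comment> \<open>On \<open>b = a + 1\<close> the secant is the displacement
    \<open>h (c a) - c a\<close>, whose logarithm \<open>G\<close> lives on the whole plane; since
    \<open>c L = c 0\<close>, there is no net change.\<close>
  obtain k1 where "\<And>a. a \<in> {0..L} \<Longrightarrow> T (a, a + 1) = G (c a) + k1"
  proof (rule continuous_exp_eq_imp_diff_const)
    show "continuous_on {0..L} (\<lambda>a. T (a, a + 1))"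
      by (rule cTp) (use L in \<open>auto intro!: continuous_intros simp: \<Delta>_def\<close>)
    show "continuous_on {0..L} (\<lambda>a. G (c a))"
      by (rule continuous_on_compose2[OF G(1) continuous_on_subset[OF cc]]) auto
    show "exp (T (a, a + 1)) = exp (G (c a))" if "a \<in> {0..L}" for a
      using T(2)[of "(a, a + 1)"] G(2)[of "c a"] ch[of a] that L by (auto simp: \<Delta>_def)
  qed auto
  from this[of 0] this[of L] L have T0: "T (0, 1) = T (L, L + 1)" by simp
  define S where "S = {0<..<L}"
  \<comment> \<open>Needed at the base points 0 and 1. The curve closes up at 1 as well, because
    \<open>c (1 + L) = h (c L) = h (c 0) = c 1\<close>.\<close>
  have swap: "\<exists>k. \<forall>a\<in>S. T (x + a, x + L) = T (x, x + a) + k"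
    if x: "0 \<le> x" "c (x + L) = c x" for x
  proof -
    obtain k where "\<And>a. a \<in> S \<Longrightarrow> T (x + a, x + L) = T (x, x + a) + \<i> * pi + k"
    proof (rule continuous_exp_eq_imp_diff_const)
      show "continuous_on S (\<lambda>a. T (x + a, x + L))"
        by (rule cTp) (use L x in \<open>auto intro!: continuous_intros simp: \<Delta>_def S_def\<close>)
      show "continuous_on S (\<lambda>a. T (x, x + a) + \<i> * pi)"
        by (intro continuous_intros cTp) (use L x in \<open>auto intro!: continuous_intros simp: \<Delta>_def S_def\<close>)
      show "exp (T (x + a, x + L)) = exp (T (x, x + a) + \<i> * pi)" if "a \<in> S" for a
      proof -
        have "exp (T (x + a, x + L)) = c x - c (x + a)" "exp (T (x, x + a)) = c (x + a) - c x"
          using T(2)[of "(x + a, x + L)"] T(2)[of "(x, x + a)"] that x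
          by (auto simp: \<Delta>_def S_def)
        then have "exp (T (x + a, x + L)) = - exp (T (x, x + a))" by (metis minus_diff_eq)
        then show ?thesis by (simp add: exp_add)
      qed
    qed (auto simp: S_def)
    then show ?thesis by (metis add.assoc)
  qed
  obtain k where k: "\<And>a. a \<in> S \<Longrightarrow> T (a, L) = T (0, a) + k"
    using swap[of 0] L by auto
  obtain k' where k': "\<And>a. a \<in> S \<Longrightarrow> T (1 + a, 1 + L) = T (1, 1 + a) + k'"
    using swap[of 1] L ch[of 0] ch[of L] by (auto simp: add.commute)
  \<comment> \<open>Adding 1 to both times applies \<open>h\<close>, which adds the logarithm of the
    slope. The constant \<nu> is the same for all pairs and cancels below.\<close>
  obtain \<nu> where \<nu>: "\<And>x. x \<in> \<Delta> \<Longrightarrow> T (fst x + 1, snd x + 1) = T x + R (c (fst x), c (snd x)) + \<nu>"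
  proof (rule continuous_exp_eq_imp_diff_const)
    show "connected \<Delta>" using \<open>convex \<Delta>\<close> by (rule convex_connected)
    show "continuous_on \<Delta> (\<lambda>x. T (fst x + 1, snd x + 1))"
      by (rule cTp) (auto intro!: continuous_intros simp: \<Delta>_def)
    have "continuous_on \<Delta> (\<lambda>x. R (c (fst x), c (snd x)))"
    proof (rule continuous_on_compose2[of "{(p, q). p \<noteq> q}" R])
      show "continuous_on \<Delta> (\<lambda>x. (c (fst x), c (snd x)))"
        by (intro continuous_on_Pair continuous_on_compose2[OF cc] continuous_intros) (auto simp: \<Delta>_def)
      show "(\<lambda>x. (c (fst x), c (snd x))) ` \<Delta> \<subseteq> {(p, q). p \<noteq> q}"
        using inj by (auto simp: \<Delta>_def)
    qed (use sl in \<open>simp add: secant_log_def\<close>)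
    then show "continuous_on \<Delta> (\<lambda>x. T x + R (c (fst x), c (snd x)))"
      by (intro continuous_intros T(1))
    show "exp (T (fst x + 1, snd x + 1)) = exp (T x + R (c (fst x), c (snd x)))" if x: "x \<in> \<Delta>" for x
    proof -
      have ne: "c (fst x) \<noteq> c (snd x)" and p: "0 \<le> fst x" "0 \<le> snd x" "(fst x + 1, snd x + 1) \<in> \<Delta>"
        using inj x by (auto simp: \<Delta>_def)
      have "exp (T (fst x + 1, snd x + 1)) = h (c (snd x)) - h (c (fst x))"
        using T(2)[OF p(3)] ch p by simp
      also have "\<dots> = (c (snd x) - c (fst x)) * exp (R (c (fst x), c (snd x)))"
        using sl ne by (simp add: secant_log_def)
      finally show ?thesis using T(2)[OF x] by (simp add: exp_add)
    qed
  qed auto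
  \<comment> \<open>As \<open>c L = c 0\<close>, the parameters \<open>(0, 1)\<close> and
    \<open>(1, L)\<close> give the same two points in opposite order. Symmetry of \<open>R\<close>
    therefore makes the interchange constants at 0 and at 1 equal.\<close>
  have "c 0 \<noteq> c 1" using inj[of 0 1] L by simp
  then have "R (c 1, c L) = R (c 0, c 1)"
    using secant_log_sym[OF sl, of "c 0" "c 1"] L by simp
  moreover have "(0, 1) \<in> \<Delta>" "(1, L) \<in> \<Delta>" using L by (auto simp: \<Delta>_def)
  from \<nu>[OF this(1)] \<nu>[OF this(2)]
  have "T (1, 2) = T (0, 1) + R (c 0, c 1) + \<nu>" "T (2, L + 1) = T (1, L) + R (c 1, c L) + \<nu>" by simp_all
  moreover have "T (1, L) = T (0, 1) + k" "T (2, L + 1) = T (1, 2) + k'"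
    using k[of 1] k'[of 1] L by (auto simp: S_def add.commute)
  ultimately have "k' = k" by simp
  \<comment> \<open>Two interchanges lead from \<open>(0, 1)\<close> to \<open>(L, L + 1)\<close>, a
    total change of \<open>2 * k\<close>, which is zero by \<open>T0\<close>; yet a single
    interchange reverses the secant.\<close>
  moreover have "T (L, L + 1) = T (1, L) + k'"
    using k'[of "L - 1"] L by (auto simp: S_def add.commute)
  ultimately have "k = 0" using T0 \<open>T (1, L) = T (0, 1) + k\<close> by simp
  moreover have "c 1 - c 0 = exp (T (0, 1))" "c 0 - c 1 = exp (T (1, L))"
    using T(2)[OF \<open>(0, 1) \<in> \<Delta>\<close>] T(2)[OF \<open>(1, L) \<in> \<Delta>\<close>] L by simp_all
  then have "exp (T (1, L)) = - exp (T (0, 1))" by (metis minus_diff_eq)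
  ultimately show False
    using \<open>T (1, L) = T (0, 1) + k\<close> by simp
qed

section \<open>Secant logarithms of compositions and inverses; pushes inside a disc\<close>

lemma secant_log_compose:
  assumes "secant_log h R" "secant_log k R'"
  shows "secant_log (\<lambda>x. h (k x)) (\<lambda>x. R (k (fst x), k (snd x)) + R' x)"
proof -
  have h: "continuous_on UNIV h" "continuous_on {(p, q). p \<noteq> q} R"
    "\<And>p q. p \<noteq> q \<Longrightarrow> h q - h p = (q - p) * exp (R (p, q))"
   and k: "continuous_on UNIV k" "continuous_on {(p, q). p \<noteq> q} R'"
    "\<And>p q. p \<noteq> q \<Longrightarrow> k q - k p = (q - p) * exp (R' (p, q))"
    using assms by (auto simp: secant_log_def)
  have inj: "k p \<noteq> k q" if "p \<noteq> q" for p q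
    using secant_log_inj[OF assms(2)] that by (auto dest: injD)
  have ck: "continuous_on A (\<lambda>x. k (u x))" if "continuous_on A u" for u and A :: "(complex \<times> complex) set"
    by (rule continuous_on_compose2[OF k(1) that]) auto
  have "continuous_on {(p, q). p \<noteq> q} (\<lambda>x. R (k (fst x), k (snd x)))"
    by (rule continuous_on_compose2[OF h(2)])
       (use inj in \<open>auto intro!: continuous_intros ck\<close>)
  moreover have "continuous_on UNIV (\<lambda>x. h (k x))"
    by (rule continuous_on_compose2[OF h(1) k(1)]) auto
  moreover have "h (k q) - h (k p) = (q - p) * exp (R (k p, k q) + R' (p, q))" if "p \<noteq> q" for p q
    using h(3)[OF inj[OF that]] k(3)[OF that] by (simp add: exp_add)
  ultimately show ?thesis
    by (simp add: secant_log_def continuous_on_add k(2))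
qed

lemma secant_log_inverse:
  assumes "secant_log h R" "continuous_on UNIV k" "\<And>x. h (k x) = x"
  shows "secant_log k (\<lambda>x. - R (k (fst x), k (snd x)))"
proof -
  have h: "continuous_on {(p, q). p \<noteq> q} R" "\<And>p q. p \<noteq> q \<Longrightarrow> h q - h p = (q - p) * exp (R (p, q))"
    using assms by (auto simp: secant_log_def)
  have inj: "k p \<noteq> k q" if "p \<noteq> q" for p q
    using assms(3) that by metis
  have ck: "continuous_on A (\<lambda>x. k (u x))" if "continuous_on A u" for u and A :: "(complex \<times> complex) set"
    by (rule continuous_on_compose2[OF assms(2) that]) auto
  have "continuous_on {(p, q). p \<noteq> q} (\<lambda>x. R (k (fst x), k (snd x)))"
    by (rule continuous_on_compose2[OF h(1)])
       (use inj in \<open>auto intro!: continuous_intros ck\<close>)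
  moreover have "k q - k p = (q - p) * exp (- R (k p, k q))" if "p \<noteq> q" for p q
    using h(2)[OF inj[OF that]] assms(3) by (simp add: exp_minus field_simps)
  ultimately show ?thesis
    using assms(2) by (simp add: secant_log_def continuous_on_minus)
qed

text \<open>All slopes of \<open>w + u w\<close> lie in the open disc of radius 1 about 1, hence in
  the right half plane, where the principal logarithm is continuous.\<close>

lemma secant_log_perturbation:
  fixes u :: "complex \<Rightarrow> complex"
  assumes "l < 1" and lip: "\<And>p q. cmod (u q - u p) \<le> l * cmod (q - p)"
  shows "secant_log (\<lambda>w. w + u w) (\<lambda>(p, q). Ln (1 + (u q - u p) / (q - p)))"
proof -
  have "0 \<le> l" using order_trans[OF norm_ge_zero lip[of 1 0]] by simp
  have "l-lipschitz_on UNIV u"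
    using lip \<open>0 \<le> l\<close> by (intro lipschitz_onI) (auto simp: dist_norm)
  then have cu: "continuous_on UNIV u" by (rule lipschitz_on_continuous_on)
  have cu': "continuous_on A (\<lambda>x. u (g x))" if "continuous_on A g" for g and A :: "(complex \<times> complex) set"
    by (rule continuous_on_compose2[OF cu that]) auto
  have small: "cmod ((u q - u p) / (q - p)) < 1" if "p \<noteq> q" for p q
  proof -
    have "cmod (u q - u p) < 1 * cmod (q - p)"
      using that \<open>l < 1\<close> by (intro le_less_trans[OF lip] mult_strict_right_mono) auto
    then show ?thesis using that by (simp add: norm_divide)
  qed
  have npos: "0 < Re (1 + (u q - u p) / (q - p))" if "p \<noteq> q" for p q
    using small[OF that] abs_Re_le_cmod[of "(u q - u p) / (q - p)"] by simp
  have "continuous_on {(p, q). p \<noteq> q} (\<lambda>x. Ln (1 + (u (snd x) - u (fst x)) / (snd x - fst x)))"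
  proof (intro continuous_intros cu')
    fix x :: "complex \<times> complex" assume "x \<in> {(p, q). p \<noteq> q}"
    then have "0 < Re (1 + (u (snd x) - u (fst x)) / (snd x - fst x))"
      by (intro npos) auto
    then show "1 + (u (snd x) - u (fst x)) / (snd x - fst x) \<notin> \<real>\<^sub>\<le>\<^sub>0"
      using complex_nonpos_Reals_iff by force
  qed auto
  moreover have "(q + u q) - (p + u p) = (q - p) * exp (Ln (1 + (u q - u p) / (q - p)))"
    if "p \<noteq> q" for p q
  proof -
    have "1 + (u q - u p) / (q - p) \<noteq> 0" using npos[OF that] by force
    then show ?thesis using that by (simp add: exp_Ln field_simps)
  qed
  ultimately show ?thesis
    using cu by (auto simp: secant_log_def case_prod_beta intro!: continuous_intros)
qed

text \<open>A solution of \<open>w + u w = y\<close> is a fixed point of the contraction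
  \<open>\<lambda>w. y - u w\<close>; the solution depends on \<open>y\<close> with Lipschitz
  constant \<open>1 / (1 - l)\<close>.\<close>

lemma bij_contraction_perturbation:
  fixes u :: "complex \<Rightarrow> complex"
  assumes "l < 1" and lip: "\<And>p q. cmod (u q - u p) \<le> l * cmod (q - p)"
  obtains k where "continuous_on UNIV k" "\<And>w. k w + u (k w) = w"
proof -
  have "0 \<le> l" using order_trans[OF norm_ge_zero lip[of 1 0]] by simp
  have "\<exists>w. w + u w = y" for y
  proof -
    have "\<exists>!w\<in>UNIV. y - u w = w"
    proof (rule Banach_fix[OF complete_UNIV _ \<open>0 \<le> l\<close> \<open>l < 1\<close>])
      show "dist (y - u a) (y - u b) \<le> l * dist a b" for a b
        using lip[of a b] by (simp add: dist_norm norm_minus_commute)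
    qed auto
    then show ?thesis by (metis diff_add_cancel)
  qed
  then obtain k where k: "\<And>w. k w + u (k w) = w" by metis
  have "(1 / (1 - l))-lipschitz_on UNIV k"
  proof (rule lipschitz_onI)
    fix p q
    have "cmod (k q - k p) = cmod ((q - p) - (u (k q) - u (k p)))"
      using k[of p] k[of q] by (metis add_diff_add add_diff_cancel_right')
    also have "\<dots> \<le> cmod (q - p) + l * cmod (k q - k p)"
      using norm_triangle_ineq4[of "q - p" "u (k q) - u (k p)"] lip[of "k q" "k p"] by linarith
    finally have "(1 - l) * cmod (k q - k p) \<le> cmod (q - p)" by (simp add: algebra_simps)
    then show "dist (k p) (k q) \<le> 1 / (1 - l) * dist p q"
      using \<open>l < 1\<close> by (simp add: dist_norm norm_minus_commute field_simps)
  qed (use \<open>l < 1\<close> in simp)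
  then show ?thesis using k that lipschitz_on_continuous_on by blast
qed

text \<open>The cone-shaped perturbation \<open>u y\<close> vanishes outside the disc, moves the
  centre \<open>x\<close> to \<open>y\<close>, and has Lipschitz constant
  \<open>cmod (y - x) / r < 1\<close>. Undoing the push for \<open>z'\<close> and then applying the
  push for \<open>z\<close> takes \<open>z'\<close> to \<open>x\<close> and on to
  \<open>z\<close>.\<close>

lemma ball_push:
  assumes "z \<in> ball x r" "z' \<in> ball x r"
  obtains \<phi> R where "secant_log \<phi> R" "\<phi> z' = z" "\<And>w. w \<notin> ball x r \<Longrightarrow> \<phi> w = w"
proof -
  have "0 < r" using assms(1) by (metis ball_eq_empty empty_iff not_le)
  define u where "u y w = (y - x) * of_real (max 0 (1 - dist w x / r))" for y w
  have lip: "cmod (u y q - u y p) \<le> (cmod (y - x) / r) * cmod (q - p)" for y p q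
  proof -
    have "u y q - u y p = (y - x) * of_real (max 0 (1 - dist q x / r) - max 0 (1 - dist p x / r))"
      by (simp add: u_def algebra_simps)
    then have "cmod (u y q - u y p) = cmod (y - x) * \<bar>max 0 (1 - dist q x / r) - max 0 (1 - dist p x / r)\<bar>"
      by (simp only: norm_mult norm_of_real)
    also have "\<bar>max 0 (1 - dist q x / r) - max 0 (1 - dist p x / r)\<bar> \<le> \<bar>dist q x / r - dist p x / r\<bar>"
      by linarith
    also have "\<bar>dist q x / r - dist p x / r\<bar> = \<bar>dist q x - dist p x\<bar> / r"
      using \<open>0 < r\<close> by (simp add: diff_divide_distrib[symmetric])
    also have "\<dots> \<le> cmod (q - p) / r"
      using \<open>0 < r\<close> by (intro divide_right_mono) (auto simp: dist_norm norm_triangle_ineq3[of "q - x" "p - x", simplified])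
    finally show ?thesis by (simp add: mult_left_mono)
  qed
  have l: "cmod (y - x) / r < 1" if "y \<in> ball x r" for y
    using that \<open>0 < r\<close> by (simp add: dist_norm norm_minus_commute)
  have out: "u y w = 0" if "w \<notin> ball x r" for y w
    using that \<open>0 < r\<close> by (simp add: u_def dist_commute field_simps)
  have ctr: "x + u y x = y" for y by (simp add: u_def)
  obtain R where R: "secant_log (\<lambda>w. w + u z w) R"
    using secant_log_perturbation[OF l[OF assms(1)] lip] by blast
  obtain R' where R': "secant_log (\<lambda>w. w + u z' w) R'"
    using secant_log_perturbation[OF l[OF assms(2)] lip] by blast
  obtain k where k: "continuous_on UNIV k" "\<And>w. k w + u z' (k w) = w"
    using bij_contraction_perturbation[OF l[OF assms(2)] lip] by blast
  have k_eq: "k w = v" if "v + u z' v = w" for v w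
    using secant_log_inj[OF R'] k(2)[of w] that by (metis injD)
  show ?thesis
  proof
    show "secant_log (\<lambda>w. k w + u z (k w)) (\<lambda>p. R (k (fst p), k (snd p)) + - R' (k (fst p), k (snd p)))"
      by (rule secant_log_compose[OF R secant_log_inverse[OF R' k]])
    show "k z' + u z (k z') = z" using k_eq[OF ctr] ctr by simp
    show "k w + u z (k w) = w" if "w \<notin> ball x r" for w
      using k_eq[of w w] out[OF that] by simp
  qed
qed

section \<open>Brouwer's lemma by a translation arc, and its version for free discs\<close>

lemma continuous_on_halfline:
  fixes c :: "real \<Rightarrow> 'a::topological_space"
  assumes "\<And>n::nat. continuous_on {real n..real n + 1} c"
  shows "continuous_on {0..} c"
proof -
  have *: "continuous_on {0..real n} c" for n
  proof (induction n)
    case (Suc n)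
    have "{0..real (Suc n)} = {0..real n} \<union> {real n..real n + 1}" by auto
    then show ?case using Suc assms[of n] by (simp only:) (intro continuous_on_closed_Un, auto)
  qed auto
  show ?thesis
    unfolding continuous_on_eq_continuous_within
  proof
    fix x :: real assume x: "x \<in> {0..}"
    obtain n :: nat where n: "x < n" using reals_Archimedean2 by blast
    have "at x within {0..} = at x within {0..real n}"
      by (rule at_within_nhd[of x "{..<real n}"]) (use n in auto)
    moreover have "continuous (at x within {0..real n}) c"
      using *[of n] n x by (auto simp: continuous_on_eq_continuous_within)
    ultimately show "continuous (at x within {0..}) c" by (simp add: continuous_within)
  qed
qed

text \<open>Blow up a disc around \<open>x\<close> until it first touches its image, say at the image of \<open>y\<close>. The
  radii from \<open>y\<close> to \<open>x\<close> and from \<open>x\<close> to \<open>h y\<close> form an arc \<open>\<alpha>\<close> whose interior is disjoint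
  from its image; \<open>x\<close> being periodic, the concatenation of the \<open>h\<^sup>n \<alpha>\<close> is not injective and a
  shortest closed piece of it contradicts \<open>no_closed_translation_path\<close>.\<close>

theorem Brouwer_periodic_point:
  assumes sl: "secant_log h R" and per: "(h ^^ m) x = x" "1 \<le> m"
  shows "\<exists>w. h w = w"
proof (rule ccontr)
  assume "\<nexists>w. h w = w"
  then have nofix: "h w \<noteq> w" for w by blast
  have ch: "continuous_on A h" for A
    using sl by (auto simp: secant_log_def intro: continuous_on_subset)
  have injh: "inj h" using sl by (rule secant_log_inj)
  \<comment> \<open>The smallest radius for which the closed disc about \<open>x\<close> contains
    both \<open>p\<close> and \<open>h p\<close>; its minimum over \<open>p\<close> is the radius of
    first contact.\<close>
  define M where "M p = max (dist x p) (dist x (h p))" for p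
  have cM: "continuous_on A M" for A
    unfolding M_def by (intro continuous_intros ch)
  obtain y where y: "\<And>p. M y \<le> M p"
  proof -
    obtain y where y: "y \<in> cball x (M x)" "\<And>p. p \<in> cball x (M x) \<Longrightarrow> M y \<le> M p"
      using continuous_attains_inf[OF compact_cball _ cM, of x "M x"]
      by (metis centre_in_cball empty_iff le_max_iff_disj M_def zero_le_dist)
    moreover have "M y \<le> M p" if "p \<notin> cball x (M x)" for p
      using that y(2)[of x] by (auto simp: M_def)
    ultimately show ?thesis using that by blast
  qed
  define r where "r = M y"
  have hball: "dist x (h p) \<ge> r" if "dist x p < r" for p
    using y[of p] that by (auto simp: r_def M_def)
  have "0 < r"
    using nofix[of y] by (auto simp: r_def M_def max_def)
  have dy: "dist x y = r"
  proof (rule ccontr)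
    assume "dist x y \<noteq> r"
    then have less: "dist x y < r" by (auto simp: r_def M_def)
    then have hy: "dist x (h y) = r" by (auto simp: r_def M_def)
    \<comment> \<open>An open set that misses the open disc also misses its closure, so
      \<open>y\<close> cannot lie in the interior. The argument for \<open>h y\<close> uses the
      preimage of the disc in place of the image.\<close>
    have "open (h ` ball x r)"
      by (rule invariance_of_domain[OF ch]) (use injh in \<open>auto intro: inj_on_subset\<close>)
    moreover have "h ` ball x r \<inter> ball x r = {}"
      using hball by fastforce
    ultimately have "h ` ball x r \<inter> closure (ball x r) = {}"
      by (simp add: open_Int_closure_eq_empty)
    moreover have "h y \<in> h ` ball x r" "h y \<in> closure (ball x r)"
      using less hy \<open>0 < r\<close> by auto
    ultimately show False by blast
  qed
  have dhy: "dist x (h y) = r"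
  proof (rule ccontr)
    assume "dist x (h y) \<noteq> r"
    then have "dist x (h y) < r" by (auto simp: r_def M_def)
    moreover have "open {p. dist x (h p) < r}"
      by (intro open_Collect_less continuous_intros ch)
    moreover have "\<forall>p\<in>{p. dist x (h p) < r}. p \<notin> ball x r" using hball by force
    then have "ball x r \<inter> {p. dist x (h p) < r} = {}" by auto
    ultimately have "closure (ball x r) \<inter> {p. dist x (h p) < r} = {}"
      by (metis Int_commute open_Int_closure_eq_empty)
    moreover have "y \<in> closure (ball x r)" using dy \<open>0 < r\<close> by auto
    ultimately show False using \<open>dist x (h y) < r\<close> by auto
  qed
  define \<alpha> where "\<alpha> s = (if s \<le> 1/2 then x + of_real (1 - 2 * s) * (y - x)
      else x + of_real (2 * s - 1) * (h y - x))" for s :: real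
  have \<alpha>0: "\<alpha> 0 = y" and \<alpha>1: "\<alpha> 1 = h y" and \<alpha>x: "\<alpha> (1/2) = x" by (auto simp: \<alpha>_def)
  have c\<alpha>: "continuous_on {0..1} \<alpha>"
  proof -
    have "continuous_on ({0..1/2} \<union> {1/2..1}) \<alpha>"
      unfolding \<alpha>_def
    proof (rule continuous_on_If)
      show "x + complex_of_real (1 - 2 * s) * (y - x) = x + complex_of_real (2 * s - 1) * (h y - x)"
        if "s \<in> {1/2..1}" "s \<le> 1/2" for s
      proof -
        have "s = 1/2" using that by simp
        show ?thesis unfolding \<open>s = 1/2\<close> by simp
      qed
    qed (auto intro!: continuous_intros)
    moreover have "{0..1/2} \<union> {1/2..1} = {0..1::real}" by auto
    ultimately show ?thesis by simp
  qed
  have d\<alpha>: "dist x (\<alpha> s) = \<bar>2 * s - 1\<bar> * r" if "0 \<le> s" "s \<le> 1" for s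
  proof (cases "s \<le> 1/2")
    case True
    then have "dist x (\<alpha> s) = cmod (of_real (1 - 2 * s) * (y - x))"
      by (simp add: \<alpha>_def dist_norm norm_minus_commute)
    also have "\<dots> = \<bar>1 - 2 * s\<bar> * r" unfolding norm_mult norm_of_real
      using dy by (simp add: dist_norm norm_minus_commute)
    finally show ?thesis by (simp add: abs_minus_commute)
  next
    case False
    then have "dist x (\<alpha> s) = cmod (of_real (2 * s - 1) * (h y - x))"
      by (simp add: \<alpha>_def dist_norm norm_minus_commute)
    also have "\<dots> = \<bar>2 * s - 1\<bar> * r" unfolding norm_mult norm_of_real
      using dhy by (simp add: dist_norm norm_minus_commute)
    finally show ?thesis .
  qed
  \<comment> \<open>Two parameters at equal distance from \<open>x\<close> add up to 1 and belong to
    different radii; their points coincide only if \<open>y = h y\<close>.\<close>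
  have inj\<alpha>: "\<alpha> s \<noteq> \<alpha> t" if "0 \<le> s" "s < t" "t \<le> 1" for s t
  proof
    assume eq: "\<alpha> s = \<alpha> t"
    have "dist x (\<alpha> s) = \<bar>2 * s - 1\<bar> * r" "dist x (\<alpha> t) = \<bar>2 * t - 1\<bar> * r"
      using that by (auto intro!: d\<alpha>)
    with eq have "\<bar>2 * s - 1\<bar> * r = \<bar>2 * t - 1\<bar> * r" by metis
    then have "\<bar>2 * s - 1\<bar> = \<bar>2 * t - 1\<bar>" using \<open>0 < r\<close> by simp
    then have t: "2 * t - 1 = 1 - 2 * s" "1/2 < t" and s: "s < 1/2"
      using that by (auto simp: abs_if split: if_splits)
    then have "x + of_real (1 - 2 * s) * (y - x) = x + of_real (2 * t - 1) * (h y - x)"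
      using eq by (simp add: \<alpha>_def)
    then have "of_real (1 - 2 * s) * (y - x) = of_real (1 - 2 * s) * (h y - x)"
      unfolding t(1) by simp
    then show False using s nofix[of y] by (auto simp del: of_real_diff)
  qed
  define c where "c t = (h ^^ nat \<lfloor>t\<rfloor>) (\<alpha> (frac t))" for t
  have cn: "c t = (h ^^ n) (\<alpha> (t - n))" if "real n \<le> t" "t \<le> real n + 1" for t n
  proof (cases "t = real n + 1")
    case True
    then have "\<lfloor>t\<rfloor> = int (Suc n)" "frac t = 0" by (auto simp: frac_def)
    then have "c t = (h ^^ Suc n) (\<alpha> 0)" by (simp only: c_def nat_int)
    then show ?thesis using True \<alpha>0 \<alpha>1 by (simp add: funpow_swap1)
  next
    case False
    then have "\<lfloor>t\<rfloor> = int n" using that by (simp add: floor_eq_iff)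
    then show ?thesis by (simp add: c_def frac_def)
  qed
  have chn: "continuous_on A (h ^^ n)" for A n
  proof (induction n)
    case (Suc n)
    then show ?case by (auto intro: continuous_on_compose2[OF ch[of UNIV]])
  qed (simp add: id_def)
  have cc: "continuous_on {0..} c"
  proof (rule continuous_on_halfline)
    fix n :: nat
    have "continuous_on {real n..real n + 1} (\<lambda>t. (h ^^ n) (\<alpha> (t - n)))"
      by (intro continuous_on_compose2[OF chn[of UNIV]] continuous_on_compose2[OF c\<alpha>] continuous_intros) auto
    then show "continuous_on {real n..real n + 1} c"
      by (rule continuous_on_cong[THEN iffD1, rotated -1]) (auto simp: cn)
  qed
  have csuc: "c (t + 1) = h (c t)" if "0 \<le> t" for t
    using that by (simp add: c_def frac_def nat_add_distrib)
  have cadd: "c (t + real n) = (h ^^ n) (c t)" if "0 \<le> t" for t n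
  proof (induction n)
    case (Suc n)
    have "c (t + real (Suc n)) = c ((t + real n) + 1)" by (simp add: algebra_simps)
    then show ?case using Suc csuc[of "t + real n"] that by simp
  qed simp
  \<comment> \<open>A gap of at most 1 involves one arc or two consecutive ones. Interior points of
    the arc lie in the open disc, and their images outside it.\<close>
  have local: "c s \<noteq> c (s + g)" if "0 \<le> s" "s < 1" "0 < g" "g \<le> 1" for s g
  proof (cases "s + g \<le> 1")
    case True
    then show ?thesis using cn[of 0 s] cn[of 0 "s + g"] inj\<alpha>[of s "s + g"] that by simp
  next
    case False
    define u where "u = s + g - 1"
    have u: "0 < u" "u \<le> s" "0 < s" using False that by (auto simp: u_def)
    have "c (s + g) = h (\<alpha> u)" using csuc[of u] cn[of 0 u] u that by (simp add: u_def)
    moreover have "dist x (h (\<alpha> u)) \<ge> r"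
    proof (rule hball)
      have "\<bar>2 * u - 1\<bar> < 1" using u that by auto
      then show "dist x (\<alpha> u) < r" using d\<alpha>[of u] u that \<open>0 < r\<close> by simp
    qed
    moreover have "dist x (c s) < r"
    proof -
      have "\<bar>2 * s - 1\<bar> < 1" using u that by auto
      then show ?thesis using d\<alpha>[of s] cn[of 0 s] u that \<open>0 < r\<close> by simp
    qed
    ultimately show ?thesis by auto
  qed
  \<comment> \<open>By \<open>local\<close> no coincidence has a gap of at most 1, so demanding
    \<open>1 \<le> g\<close> loses nothing and keeps \<open>D\<close> compact. Starting parameters
    in \<open>{0..1}\<close> suffice, because \<open>h\<close> is injective and any coincidence can
    be shifted back by an integer.\<close>
  define D where "D = {(s, g). (s, g) \<in> {0..1} \<times> {1..real m} \<and> c s = c (s + g)}"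
  have "compact D"
  proof -
    have "closedin (top_of_set ({0..1} \<times> {1..real m}))
        (({0..1} \<times> {1..real m}) \<inter> (\<lambda>x. c (fst x) - c (fst x + snd x)) -` {0})"
      by (intro continuous_closedin_preimage continuous_on_diff continuous_on_compose2[OF cc] continuous_intros) auto
    moreover have "({0..1} \<times> {1..real m}) \<inter> (\<lambda>x. c (fst x) - c (fst x + snd x)) -` {0} = D"
      by (auto simp: D_def)
    ultimately show ?thesis
      by (metis closedin_compact compact_Icc compact_Times)
  qed
  moreover have "(1/2, real m) \<in> D"
    using per cadd[of "1/2" m] cn[of 0 "1/2"] \<alpha>x by (simp add: D_def)
  ultimately obtain sL where sL: "sL \<in> D" "\<And>p. p \<in> D \<Longrightarrow> snd sL \<le> snd p"
    using continuous_attains_inf[of D snd] continuous_on_snd[OF continuous_on_id] by blast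
  obtain s L where sl_eq: "sL = (s, L)" by fastforce
  have s: "0 \<le> s" "s \<le> 1" "1 \<le> L" "L \<le> m" "c s = c (s + L)"
    using sL(1) by (auto simp: D_def sl_eq)
  have "L \<noteq> 1" using s csuc[of s] nofix[of "c s"] by auto
  show False
  proof (rule no_closed_translation_path[OF sl nofix, of "\<lambda>t. c (s + t)" L])
    show "continuous_on {0..} (\<lambda>t. c (s + t))"
      by (intro continuous_on_compose2[OF cc] continuous_intros) (use s in auto)
    show "c (s + (t + 1)) = h (c (s + t))" if "0 \<le> t" for t
      using csuc[of "s + t"] s that by (simp add: add.assoc)
    show "1 < L" using s \<open>L \<noteq> 1\<close> by simp
    show "c (s + L) = c (s + 0)" using s by simp
    fix a b assume ab: "0 \<le> a" "a < b" "b < a + L"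
    show "c (s + a) \<noteq> c (s + b)"
    proof
      assume eq: "c (s + a) = c (s + b)"
      define n where "n = nat \<lfloor>s + a\<rfloor>"
      define f where "f = frac (s + a)"
      have f: "0 \<le> f" "f < 1" "s + a = f + n" using ab s frac_lt_1[of "s + a"] by (auto simp: f_def n_def frac_def)
      have "(h ^^ n) (c f) = (h ^^ n) (c (f + (b - a)))"
      proof -
        have "s + b = f + (b - a) + n" using f by simp
        with eq f(3) have "c (f + real n) = c (f + (b - a) + real n)" by metis
        then show ?thesis using cadd[of f n] cadd[of "f + (b - a)" n] f ab by simp
      qed
      then have ceq: "c f = c (f + (b - a))"
        using inj_fn[OF injh] by (metis injD)
      show False
      proof (cases "b - a \<le> 1")
        case True
        then show False using local[of f "b - a"] f ab ceq by auto
      next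
        case False
        then have "(f, b - a) \<in> D" using f ab s ceq by (auto simp: D_def)
        then show False using sL(2)[of "(f, b - a)"] ab by (simp add: sl_eq)
      qed
    qed
  qed
qed

text \<open>At a shortest return to the disc the intermediate points stay outside it. A push
  supported in the disc that sends the returning point back to its start leaves them alone and makes
  the orbit periodic under the modified map, so Brouwer's lemma applies. The fixed point so obtained
  cannot involve the disc, which is free, and is therefore fixed by \<open>h\<close> itself.\<close>

theorem Franks_free_disc:
  assumes sl: "secant_log h R" and free: "h ` ball x r \<inter> ball x r = {}"
    and ret: "z \<in> ball x r" "(h ^^ m) z \<in> ball x r" "1 \<le> m"
  shows "\<exists>w. h w = w"
proof (rule ccontr)
  assume nofix: "\<nexists>w. h w = w"
  define P where "P m \<longleftrightarrow> 1 \<le> m \<and> (\<exists>z\<in>ball x r. (h ^^ m) z \<in> ball x r)" for m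
  define n where "n = (LEAST m. P m)"
  have "P m" using ret by (auto simp: P_def)
  then have "P n" unfolding n_def by (rule LeastI)
  then obtain z where n: "1 \<le> n" "z \<in> ball x r" "(h ^^ n) z \<in> ball x r" by (auto simp: P_def)
  have early: "(h ^^ i) z \<notin> ball x r" if "1 \<le> i" "i < n" for i
    using not_less_Least[of i P] that n by (auto simp: P_def n_def)
  obtain \<phi> R' where \<phi>: "secant_log \<phi> R'" "\<phi> ((h ^^ n) z) = z" "\<And>w. w \<notin> ball x r \<Longrightarrow> \<phi> w = w"
    using ball_push[OF n(2,3)] by blast
  have \<phi>_in: "\<phi> w \<in> ball x r" if "w \<in> ball x r" for w
    using \<phi>(3)[of "\<phi> w"] secant_log_inj[OF \<phi>(1)] that by (metis injD)
  have orbit: "((\<lambda>w. \<phi> (h w)) ^^ i) z = (h ^^ i) z" if "i < n" for i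
    using that
  proof (induction i)
    case (Suc i)
    then show ?case using early[of "Suc i"] by (simp add: \<phi>(3))
  qed simp
  obtain k where k: "n = Suc k" using n(1) by (cases n) auto
  have "((\<lambda>w. \<phi> (h w)) ^^ n) z = z"
    using orbit[of k] \<phi>(2) by (simp add: k)
  from Brouwer_periodic_point[OF secant_log_compose[OF \<phi>(1) sl] this n(1)]
  obtain w where w: "\<phi> (h w) = w" by blast
  show False
  proof (cases "h w \<in> ball x r")
    case True
    then have "w \<in> ball x r" using \<phi>_in w by metis
    then show False using True free by blast
  next
    case False
    then show False using \<phi>(3) w nofix by metis
  qed
qed

section \<open>Lifts of torus homeomorphisms\<close>

lemma lattice_valued_constant:
  fixes g :: "'a::topological_space \<Rightarrow> plane"
  assumes "connected S" "continuous_on S g" "\<And>x. x \<in> S \<Longrightarrow> g x \<in> lattice"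
    and "x \<in> S" "y \<in> S"
  shows "g x = g y"
proof -
  have *: "\<pi> (g x) = \<pi> (g y)"
    if c: "continuous_on UNIV \<pi>" and i: "\<And>v. v \<in> lattice \<Longrightarrow> \<pi> v \<in> \<int>" for \<pi> :: "plane \<Rightarrow> real"
  proof -
    have "(\<lambda>x. \<pi> (g x)) constant_on S"
    proof (rule continuous_discrete_range_constant[OF assms(1)])
      show "continuous_on S (\<lambda>x. \<pi> (g x))"
        by (rule continuous_on_compose2[OF c assms(2)]) auto
      fix x assume x: "x \<in> S"
      have "1 \<le> norm (\<pi> (g y) - \<pi> (g x))" if "y \<in> S" "\<pi> (g y) \<noteq> \<pi> (g x)" for y
        using Ints_nonzero_abs_ge1[of "\<pi> (g y) - \<pi> (g x)"] i assms(3) x that by auto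
      then show "\<exists>e>0. \<forall>y. y \<in> S \<and> \<pi> (g y) \<noteq> \<pi> (g x) \<longrightarrow> e \<le> norm (\<pi> (g y) - \<pi> (g x))"
        by (intro exI[of _ 1]) auto
    qed
    then show ?thesis using assms(4,5) by (auto simp: constant_on_def)
  qed
  have "fst (g x) = fst (g y)" "snd (g x) = snd (g y)"
    by (rule *; auto simp: lattice_def intro!: continuous_intros)+
  then show ?thesis by (simp add: prod_eq_iff)
qed

lemma lifts_differ_by_lattice:
  fixes F1 F2 :: "plane \<Rightarrow> plane"
  assumes "continuous_on UNIV F1" "continuous_on UNIV F2" "\<And>z. proj (F1 z) = proj (F2 z)"
  obtains u where "u \<in> lattice" "\<And>z. F1 z = F2 z + u"
proof -
  have "F1 z - F2 z = F1 0 - F2 0" for z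
    by (rule lattice_valued_constant[of UNIV "\<lambda>z. F1 z - F2 z"])
       (use assms in \<open>auto intro!: continuous_intros simp: proj_eq_iff\<close>)
  then show ?thesis
    using that[of "F1 0 - F2 0"] assms(3)[of 0]
    by (metis add.commute diff_add_cancel proj_eq_iff)
qed

lemma continuous_on_torus:
  fixes g :: "torus \<Rightarrow> 'a::topological_space"
  assumes "continuous_on UNIV (\<lambda>z. g (proj z))"
  shows "continuous_on UNIV g"
proof -
  have "open (g -` U)" if "open U" for U
    using open_vimage[OF that assms] by (simp add: open_torus_iff vimage_def)
  then show ?thesis by (simp add: continuous_on_open_vimage)
qed

lemma proj_add_lattice: "u \<in> lattice \<Longrightarrow> proj (z + u) = proj z"
  by (simp add: proj_eq_iff)

text \<open>Characters turn the lifting of maps into the torus into a choice of complex logarithms,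
  one for each coordinate.\<close>

lemma torus_character:
  fixes \<pi> :: "plane \<Rightarrow> real"
  assumes "\<pi> = fst \<or> \<pi> = snd"
  obtains e :: "torus \<Rightarrow> complex" where "continuous_on UNIV e"
    "\<And>z. e (proj z) = exp (2 * pi * \<i> * \<pi> z)"
proof -
  have "\<exists>e. \<forall>z. e (proj z) = exp (2 * pi * \<i> * \<pi> z)"
  proof -
    define e where "e x = exp (2 * pi * \<i> * \<pi> (SOME z. proj z = x))" for x
    have "e (proj z) = exp (2 * pi * \<i> * \<pi> z)" for z
    proof -
      define w where "w = (SOME w. proj w = proj z)"
      have "proj w = proj z" unfolding w_def by (rule someI[of _ z]) simp
      then have "\<pi> w - \<pi> z \<in> \<int>"
        using assms by (auto simp: proj_eq_iff lattice_def mem_Times_iff)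
      then obtain n :: int where "\<pi> w = \<pi> z + n"
        by (metis Ints_cases add.commute diff_add_cancel)
      then have "2 * pi * \<i> * \<pi> w = 2 * pi * \<i> * \<pi> z + (of_int (2 * n) * pi) * \<i>"
        by (simp add: algebra_simps)
      then show ?thesis by (auto simp: e_def exp_eq simp flip: w_def)
    qed
    then show ?thesis by blast
  qed
  then obtain e where e: "\<And>z. e (proj z) = exp (2 * pi * \<i> * \<pi> z)" by blast
  have "continuous_on UNIV e"
    by (rule continuous_on_torus) (use assms in \<open>auto simp: e intro!: continuous_intros\<close>)
  with e show ?thesis using that by blast
qed

text \<open>The strip \<open>{0..1} \<times> UNIV\<close> is convex, so both characters of the
  isotopy have logarithms on it, and these give the coordinates of the lift. For injectivity, equal
  values force the arguments to differ by a lattice vector, which equivariance then shows to be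
  zero.\<close>

lemma isotopy_lift:
  assumes "f \<in> Homeo0"
  obtains H :: "real \<times> plane \<Rightarrow> plane" where
    "continuous_on ({0..1} \<times> UNIV) H" "\<And>z. H (0, z) = z" "\<And>z. proj (H (1, z)) = f (proj z)"
    "\<And>t z u. t \<in> {0..1} \<Longrightarrow> u \<in> lattice \<Longrightarrow> H (t, z + u) = H (t, z) + u"
    "\<And>t z w. t \<in> {0..1} \<Longrightarrow> H (t, z) = H (t, w) \<Longrightarrow> z = w"
proof -
  obtain k :: "real \<times> torus \<Rightarrow> torus" where k: "continuous_on ({0..1} \<times> UNIV) k"
    "\<And>x. k (0, x) = x" "\<And>x. k (1, x) = f x" "\<And>t. t \<in> {0..1} \<Longrightarrow> homeo (\<lambda>x. k (t, x))"
  proof -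
    have "prod_topology (top_of_set {0..1::real}) euclidean = top_of_set ({0..1} \<times> (UNIV :: torus set))"
      by (metis prod_topology_subtopology_eu subtopology_UNIV)
    then show ?thesis
      using assms that by (auto simp: Homeo0_def homotopic_with_def)
  qed
  let ?S = "{0..1} \<times> UNIV :: (real \<times> plane) set"
  have cS: "convex ?S" by (intro convex_Times) auto
  have ck: "continuous_on ?S (\<lambda>x. k (fst x, proj (snd x)))"
    by (rule continuous_on_compose2[OF k(1)])
       (auto intro!: continuous_intros continuous_on_compose2[OF continuous_on_proj[of UNIV]])
  have coord: "\<exists>a. continuous_on ?S a \<and>
      (\<forall>x\<in>?S. \<forall>z. proj z = k (fst x, proj (snd x)) \<longrightarrow> a x - \<pi> z \<in> \<int>)"
    if \<pi>: "\<pi> = fst \<or> \<pi> = snd" for \<pi> :: "plane \<Rightarrow> real"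
  proof -
    obtain e where e: "continuous_on UNIV e" "\<And>z. e (proj z) = exp (2 * pi * \<i> * \<pi> z)"
      using torus_character[OF \<pi>] by blast
    have ne: "e x \<noteq> 0" for x using e(2) by (metis exp_not_eq_zero proj_surj)
    have "continuous_on ?S (\<lambda>x. e (k (fst x, proj (snd x))))"
      by (rule continuous_on_compose2[OF e(1) ck]) auto
    then obtain l where l: "continuous_on ?S l" "\<And>x. x \<in> ?S \<Longrightarrow> e (k (fst x, proj (snd x))) = exp (l x)"
      using continuous_logarithm_on_contractible[OF _ convex_imp_contractible[OF cS], of "\<lambda>x. e (k (fst x, proj (snd x)))"] ne
      by blast
    show ?thesis
    proof (intro exI conjI ballI allI impI)
      show "continuous_on ?S (\<lambda>x. Im (l x) / (2 * pi))" by (intro continuous_intros l(1)) auto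
      fix x z assume x: "x \<in> ?S" and z: "proj z = k (fst x, proj (snd x))"
      have "exp (l x) = exp (2 * pi * \<i> * \<pi> z)" using l(2)[OF x] e(2)[of z] z by simp
      then obtain n :: int where n: "l x = 2 * pi * \<i> * \<pi> z + (of_int (2 * n) * pi) * \<i>"
        by (auto simp: exp_eq)
      have "Im (l x) / (2 * pi) = \<pi> z + n" unfolding n by (simp add: field_simps)
      then show "Im (l x) / (2 * pi) - \<pi> z \<in> \<int>" by simp
    qed
  qed
  obtain a where a: "continuous_on ?S a"
    "\<And>x z. x \<in> ?S \<Longrightarrow> proj z = k (fst x, proj (snd x)) \<Longrightarrow> a x - fst z \<in> \<int>"
    using coord[of fst] by blast
  obtain b where b: "continuous_on ?S b"
    "\<And>x z. x \<in> ?S \<Longrightarrow> proj z = k (fst x, proj (snd x)) \<Longrightarrow> b x - snd z \<in> \<int>"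
    using coord[of snd] by blast
  \<comment> \<open>The isotopy starts at the identity, so the value at \<open>(0, 0)\<close> is a
    lattice vector; subtracting it makes the lift start at the identity too.\<close>
  define H where "H x = (a x, b x) - (a (0, 0), b (0, 0))" for x
  have cH: "continuous_on ?S H" unfolding H_def by (intro continuous_intros a b)
  have l0: "(a (0, 0), b (0, 0)) \<in> lattice"
    using a(2)[of "(0, 0)" 0] b(2)[of "(0, 0)" 0] k(2) by (simp add: lattice_def)
  have pH: "proj (H x) = k (fst x, proj (snd x))" if "x \<in> ?S" for x
  proof -
    obtain z where z: "proj z = k (fst x, proj (snd x))" by (rule proj_surj)
    have "(a x, b x) - z \<in> lattice"
      using a(2)[OF that z] b(2)[OF that z] by (cases z) (auto simp: lattice_def)
    from lattice_closed_under(4)[OF this l0] have "H x - z \<in> lattice"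
      unfolding H_def by (simp only: diff_diff_eq add.commute)
    then show ?thesis using z by (metis proj_eq_iff)
  qed
  have conn: "connected ?S" using cS by (rule convex_connected)
  have H0: "H (0, z) = z" for z
  proof -
    have "H (0, z) - z = H (0, 0) - 0"
      by (rule lattice_valued_constant[of UNIV "\<lambda>z. H (0, z) - z"])
         (use pH k(2) in \<open>auto intro!: continuous_intros continuous_on_compose2[OF cH] simp flip: proj_eq_iff\<close>)
    then show ?thesis by (simp add: H_def)
  qed
  have equi: "H (t, z + u) = H (t, z) + u" if "t \<in> {0..1}" "u \<in> lattice" for t z u
  proof -
    \<comment> \<open>The defect of equivariance is lattice valued, hence constant on the strip, and
      zero at time 0.\<close>
    define g where "g x = H (fst x, snd x + u) - (H x + u)" for x
    have "g (t, z) = g (0, 0)"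
    proof (rule lattice_valued_constant[OF conn])
      show "continuous_on ?S g"
        unfolding g_def by (intro continuous_intros cH continuous_on_compose2[OF cH]) auto
      show "g x \<in> lattice" if "x \<in> ?S" for x
      proof -
        have "proj (H (fst x, snd x + u)) = proj (H x)"
          using pH[of "(fst x, snd x + u)"] pH[of x] that \<open>u \<in> lattice\<close>
          by (simp add: proj_add_lattice mem_Times_iff)
        then show ?thesis
          using \<open>u \<in> lattice\<close> unfolding g_def by (metis proj_add_lattice proj_eq_iff)
      qed
    qed (use that in auto)
    then show ?thesis by (simp add: H0 g_def)
  qed
  show ?thesis
  proof
    show "continuous_on ?S H" "\<And>z. H (0, z) = z" by fact+
    show "proj (H (1, z)) = f (proj z)" for z using pH[of "(1, z)"] k(3) by simp
    show "H (t, z + u) = H (t, z) + u" if "t \<in> {0..1}" "u \<in> lattice" for t z u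
      using equi that by blast
    fix t z w assume t: "t \<in> {0..1}" and eq: "H (t, z) = H (t, w)"
    have "k (t, proj z) = k (t, proj w)" using pH[of "(t, z)"] pH[of "(t, w)"] t eq by simp
    moreover have "inj (\<lambda>x. k (t, x))"
      using k(4)[OF t] by (auto simp: homeo_def homeomorphism_def intro: inj_on_inverseI)
    ultimately have "z - w \<in> lattice" by (metis injD proj_eq_iff)
    from equi[OF t this, of w] eq have "z - w = 0" by simp
    then show "z = w" by simp
  qed
qed

definition conj_complex :: "(plane \<Rightarrow> plane) \<Rightarrow> complex \<Rightarrow> complex" where
  "conj_complex F c = (let z = F (Re c, Im c) in Complex (fst z) (snd z))"

text \<open>The space of pairs \<open>p \<noteq> q\<close> is not simply connected, so nonvanishing
  slopes alone do not give a logarithm. Injectivity at every time deforms them through nonvanishing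
  functions to the slopes of the identity, the constant 1.\<close>

lemma secant_log_isotopic_lift:
  fixes H :: "real \<times> plane \<Rightarrow> plane"
  assumes cH: "continuous_on ({0..1} \<times> UNIV) H" and H0: "\<And>z. H (0, z) = z"
    and inj: "\<And>t z w. t \<in> {0..1} \<Longrightarrow> H (t, z) = H (t, w) \<Longrightarrow> z = w"
  obtains R where "secant_log (conj_complex (\<lambda>z. H (1, z))) R"
proof -
  define h where "h t = conj_complex (\<lambda>z. H (t, z))" for t
  have h_eq: "h t c = of_real (fst (H (t, Re c, Im c))) + \<i> * of_real (snd (H (t, Re c, Im c)))" for t c
    by (simp add: h_def conj_complex_def Let_def complex_eq_iff)
  have ch: "continuous_on A (\<lambda>x. h (u x) (v x))"
    if "continuous_on A u" "continuous_on A v" "u ` A \<subseteq> {0..1}"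
    for u v and A :: "'x::topological_space set"
    unfolding h_eq
    by (intro continuous_intros continuous_on_compose2[OF cH] that) (use that in auto)
  have hinj: "h t p \<noteq> h t q" if "t \<in> {0..1}" "p \<noteq> q" for t p q
  proof
    assume "h t p = h t q"
    then have "H (t, Re p, Im p) = H (t, Re q, Im q)"
      by (simp add: h_def conj_complex_def Let_def prod_eq_iff)
    from inj[OF that(1) this] show False using that(2) by (simp add: complex_eq_iff)
  qed
  have h0: "h 0 c = c" for c by (simp add: h_eq H0 complex_eq_iff)
  define S :: "(complex \<times> complex) set" where "S = {(p, q). p \<noteq> q}"
  define Q where "Q t x = (h t (snd x) - h t (fst x)) / (snd x - fst x)" for t x
  \<comment> \<open>Time runs backwards, from the slopes of the lift to the constant 1.\<close>
  have cQ: "continuous_on ({0..1} \<times> S) (\<lambda>y. Q (1 - fst y) (snd y))"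
    unfolding Q_def by (intro continuous_intros ch) (auto simp: S_def)
  have "homotopic_with_canon (\<lambda>_. True) S (-{0}) (Q 1) (\<lambda>_. 1)"
  proof (subst homotopic_with, simp, intro exI[of _ "\<lambda>y. Q (1 - fst y) (snd y)"] conjI)
    have "Q (1 - t) x \<noteq> 0" if "t \<in> {0..1}" "x \<in> S" for t x
      using hinj[of "1 - t" "fst x" "snd x"] that by (auto simp: Q_def S_def)
    then show "continuous_map (prod_topology (top_of_set {0..1}) (top_of_set S)) (top_of_set (- {0}))
        (\<lambda>y. Q (1 - fst y) (snd y))"
      using cQ by (auto simp: continuous_map_in_subtopology)
  qed (auto simp: Q_def h0 S_def)
  then obtain g where "continuous_on S g" "\<And>x. x \<in> S \<Longrightarrow> Q 1 x = exp (g x)"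
    using inessential_eq_continuous_logarithm by metis
  then have "secant_log (h 1) g"
    using ch[of UNIV "\<lambda>_. 1" id] 
    by (auto simp: secant_log_def S_def Q_def field_simps)
  then show ?thesis using that by (simp add: h_def)
qed

section \<open>Rotation vectors and deviations\<close>

definition equivariant :: "(plane \<Rightarrow> plane) \<Rightarrow> bool" where
  "equivariant F \<longleftrightarrow> (\<forall>z. \<forall>u\<in>lattice. F (z + u) = F z + u)"

lemma equivariantD: "equivariant F \<Longrightarrow> u \<in> lattice \<Longrightarrow> F (z + u) = F z + u"
  unfolding equivariant_def by blast

lemma equivariant_funpow:
  assumes "equivariant F" "u \<in> lattice"
  shows "(F ^^ n) (z + u) = (F ^^ n) z + u"
  by (induction n) (simp_all add: equivariantD[OF assms])

lemma lattice_scale: "u \<in> lattice \<Longrightarrow> real n *\<^sub>R u \<in> lattice"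
  by (auto simp: lattice_def mem_Times_iff)

lemma funpow_translate:
  assumes "equivariant F" "u \<in> lattice"
  shows "((\<lambda>z. F z + u) ^^ n) z = (F ^^ n) z + real n *\<^sub>R u"
proof (induction n)
  case (Suc n)
  then show ?case
    by (simp add: equivariantD[OF assms(1) lattice_scale[OF assms(2)]] scaleR_left_distrib)
qed simp

lemma is_lift_continuous: "is_lift F f \<Longrightarrow> continuous_on A F"
  by (auto simp: is_lift_def homeo_def homeomorphism_def intro: continuous_on_subset)

lemma is_lift_proj: "is_lift F f \<Longrightarrow> proj (F z) = f (proj z)"
  unfolding is_lift_def by blast

lemma is_lift_funpow_proj: "is_lift F f \<Longrightarrow> proj ((F ^^ n) z) = (f ^^ n) (proj z)"
  by (induction n) (simp_all add: is_lift_proj)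

lemma continuous_on_funpow:
  fixes F :: "'a::topological_space \<Rightarrow> 'a"
  assumes "continuous_on UNIV F"
  shows "continuous_on A (F ^^ n)"
proof (induction n)
  case (Suc n)
  then show ?case by (auto intro: continuous_on_compose2[OF assms])
qed (simp add: id_def)

lemma is_lift_translate:
  assumes "is_lift F f" "u \<in> lattice"
  shows "is_lift (\<lambda>z. F z + u) f"
proof -
  obtain g where g: "homeomorphism UNIV UNIV F g" using assms by (auto simp: is_lift_def homeo_def)
  have "homeomorphism UNIV UNIV (\<lambda>z. F z + u) (\<lambda>z. g (z - u))"
  proof (rule homeomorphismI)
    show "continuous_on UNIV (\<lambda>z. F z + u)" "continuous_on UNIV (\<lambda>z. g (z - u))"
      using homeomorphism_cont1[OF g] homeomorphism_cont2[OF g]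
      by (auto intro!: continuous_intros intro: continuous_on_compose2)
  qed (simp_all add: homeomorphism_apply1[OF g] homeomorphism_apply2[OF g])
  then show ?thesis using assms by (auto simp: is_lift_def homeo_def proj_add_lattice)
qed

lemma conj_complex_funpow: "conj_complex F ^^ n = conj_complex (F ^^ n)"
  by (induction n) (auto simp: conj_complex_def Let_def fun_eq_iff complex_eq_iff)

lemma secant_log_translate:
  "secant_log h R \<Longrightarrow> secant_log (\<lambda>c. h c + v) R"
  by (auto simp: secant_log_def intro!: continuous_intros)

lemma secant_log_funpow:
  assumes "secant_log h R"
  obtains R' where "secant_log (h ^^ n) R'"
proof -
  have "\<exists>R'. secant_log (h ^^ n) R'"
  proof (induction n)
    case 0
    have "secant_log (h ^^ 0) (\<lambda>_. 0)" by (auto simp: secant_log_def id_def)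
    then show ?case by blast
  next
    case (Suc n)
    then obtain R' where "secant_log (h ^^ n) R'" by blast
    from secant_log_compose[OF assms this] show ?case by (auto simp: o_def)
  qed
  then show ?thesis using that by blast
qed

text \<open>Every lift is the end of the lifted isotopy followed by a lattice translation, and both
  properties survive such a translation.\<close>

lemma lift_of_Homeo0:
  assumes "f \<in> Homeo0" "is_lift F f"
  shows "equivariant F" "\<exists>R. secant_log (conj_complex F) R"
proof -
  obtain H :: "real \<times> plane \<Rightarrow> plane" where H:
    "continuous_on ({0..1} \<times> UNIV) H" "\<And>z. H (0, z) = z" "\<And>z. proj (H (1, z)) = f (proj z)"
    "\<And>t z u. t \<in> {0..1} \<Longrightarrow> u \<in> lattice \<Longrightarrow> H (t, z + u) = H (t, z) + u"
    "\<And>t z w. t \<in> {0..1} \<Longrightarrow> H (t, z) = H (t, w) \<Longrightarrow> z = w"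
    using isotopy_lift[OF assms(1)] by blast
  have "continuous_on UNIV (\<lambda>z. H (1, z))"
    by (intro continuous_on_compose2[OF H(1)] continuous_intros) auto
  then obtain u where u: "u \<in> lattice" "\<And>z. F z = H (1, z) + u"
    using lifts_differ_by_lattice[OF is_lift_continuous[OF assms(2)], of "\<lambda>z. H (1, z)"]
      H(3) is_lift_proj[OF assms(2)] by metis
  show "equivariant F" by (simp add: equivariant_def u(2) H(4) algebra_simps)
  obtain R where R: "secant_log (conj_complex (\<lambda>z. H (1, z))) R"
    by (rule secant_log_isotopic_lift[OF H(1,2,5)])
  have "conj_complex F = (\<lambda>c. conj_complex (\<lambda>z. H (1, z)) c + Complex (fst u) (snd u))"
    by (auto simp: conj_complex_def Let_def u(2) complex_eq_iff)
  then show "\<exists>R. secant_log (conj_complex F) R"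
    using secant_log_translate[OF R] by metis
qed

lemma plane_free_disc_fixed_point:
  assumes "secant_log (conj_complex G) R"
    and free: "\<And>w. w \<in> ball x r \<Longrightarrow> G w \<notin> ball x r"
    and ret: "z \<in> ball x r" "(G ^^ m) z \<in> ball x r" "1 \<le> m"
  shows "\<exists>w. G w = w"
proof -
  define \<kappa> where "\<kappa> z = Complex (fst z) (snd z)" for z
  define \<kappa>' where "\<kappa>' c = (Re c, Im c)" for c
  have inv: "\<kappa> (\<kappa>' c) = c" "\<kappa>' (\<kappa> z) = z" for c z by (auto simp: \<kappa>_def \<kappa>'_def)
  have dist\<kappa>: "dist (\<kappa> a) (\<kappa> b) = dist a b" for a b
    by (simp add: \<kappa>_def dist_norm complex_diff cmod_def norm_prod_def)
  have mem: "\<kappa> a \<in> ball (\<kappa> b) r \<longleftrightarrow> a \<in> ball b r" for a b by (simp add: dist\<kappa>)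
  have conj: "conj_complex F c = \<kappa> (F (\<kappa>' c))" for F c
    by (simp add: conj_complex_def \<kappa>_def \<kappa>'_def Let_def)
  have "conj_complex G ` ball (\<kappa> x) r \<inter> ball (\<kappa> x) r = {}"
  proof -
    have "conj_complex G c \<notin> ball (\<kappa> x) r" if "c \<in> ball (\<kappa> x) r" for c
      using free[of "\<kappa>' c"] mem[of "\<kappa>' c" x] mem[of "G (\<kappa>' c)" x] that
      by (simp only: conj inv) simp
    then show ?thesis by blast
  qed
  moreover have "(conj_complex G ^^ m) (\<kappa> z) \<in> ball (\<kappa> x) r"
    unfolding conj_complex_funpow conj inv by (simp only: mem ret)
  ultimately obtain c where "conj_complex G c = c"
    using Franks_free_disc[OF assms(1) _ _ _ ret(3)] mem ret(1) by metis
  then have "G (\<kappa>' c) = \<kappa>' c" by (metis conj inv)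
  then show ?thesis by blast
qed

text \<open>Equivariance makes the displacement periodic, so a bound on the closed unit square holds
  everywhere.\<close>

lemma equivariant_displacement_bounded:
  assumes "equivariant F" "continuous_on UNIV F"
  obtains D where "0 \<le> D" "\<And>z n. norm ((F ^^ n) z - z) \<le> real n * D"
proof -
  have "compact ((\<lambda>z. F z - z) ` ({0..1} \<times> {0..1}))"
    by (intro compact_continuous_image compact_Times continuous_intros continuous_on_subset[OF assms(2)]) auto
  then have "bounded ((\<lambda>z. F z - z) ` ({0..1} \<times> {0..1}))" by (rule compact_imp_bounded)
  then obtain D where D: "\<And>z. z \<in> {0..1} \<times> {0..1} \<Longrightarrow> norm (F z - z) \<le> D"
    by (auto simp: bounded_iff)
  have D1: "norm (F z - z) \<le> D" for z
  proof -
    define u where "u = (real_of_int \<lfloor>fst z\<rfloor>, real_of_int \<lfloor>snd z\<rfloor>)"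
    have "z - u \<in> {0..1} \<times> {0..1}"
      by (cases z) (auto simp: u_def; linarith)
    moreover have "u \<in> lattice" by (simp add: u_def lattice_def)
    with assms(1) have "F z = F (z - u) + u"
      unfolding equivariant_def by (metis diff_add_cancel)
    then have "F z - z = F (z - u) - (z - u)" by (simp add: algebra_simps)
    ultimately show ?thesis using D by metis
  qed
  have "norm ((F ^^ n) z - z) \<le> real n * D" for n z
  proof (induction n)
    case (Suc n)
    have "(F ^^ Suc n) z - z = (F ((F ^^ n) z) - (F ^^ n) z) + ((F ^^ n) z - z)" by simp
    also have "norm \<dots> \<le> D + real n * D" by (intro norm_triangle_mono D1 Suc)
    finally show ?case by (simp add: algebra_simps)
  qed simp
  moreover have "0 \<le> D" using D1[of 0] norm_ge_zero order_trans by blast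
  ultimately show ?thesis using that by blast
qed

text \<open>The rotation set lets the base point vary with the time, which is why the estimate is
  uniform in \<open>z\<close>. Violations at arbitrarily large times have normalised displacements
  in a compact disc, and a limit of these would be an element of the rotation set at distance at
  least \<epsilon> from \<omega>.\<close>

lemma rotation_set_singleton_uniform:
  assumes "equivariant F" "continuous_on UNIV F" "rotation_set F = {\<omega>}" "0 < \<epsilon>"
  obtains N where "\<And>n z. n \<ge> N \<Longrightarrow> norm ((F ^^ n) z - z - real n *\<^sub>R \<omega>) \<le> \<epsilon> * real n"
proof -
  obtain D where D: "0 \<le> D" "\<And>z n. norm ((F ^^ n) z - z) \<le> real n * D"
    using equivariant_displacement_bounded[OF assms(1,2)] by blast
  have "\<exists>N. \<forall>n\<ge>N. \<forall>z. norm ((F ^^ n) z - z - real n *\<^sub>R \<omega>) \<le> \<epsilon> * real n"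
  proof (rule ccontr)
    assume "\<not> ?thesis"
    then have "\<forall>i. \<exists>n z. Suc i \<le> n \<and> \<epsilon> * real n < norm ((F ^^ n) z - z - real n *\<^sub>R \<omega>)"
      by (meson not_le)
    then obtain n z where nz: "\<And>i. Suc i \<le> n i"
      "\<And>i. \<epsilon> * real (n i) < norm ((F ^^ n i) (z i) - z i - real (n i) *\<^sub>R \<omega>)"
      by metis
    define a where "a i = ((F ^^ n i) (z i) - z i) /\<^sub>R real (n i)" for i
    have npos: "0 < real (n i)" for i using nz(1)[of i] by simp
    have far: "\<epsilon> < norm (a i - \<omega>)" for i
    proof -
      have "(F ^^ n i) (z i) - z i - real (n i) *\<^sub>R \<omega> = real (n i) *\<^sub>R (a i - \<omega>)"
        using npos[of i] by (simp add: a_def scaleR_diff_right)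
      then have "norm ((F ^^ n i) (z i) - z i - real (n i) *\<^sub>R \<omega>) = real (n i) * norm (a i - \<omega>)" by simp
      then show ?thesis using nz(2)[of i] npos[of i] by (simp add: mult.commute)
    qed
    have "a i \<in> cball 0 D" for i
    proof -
      have "norm (a i) = norm ((F ^^ n i) (z i) - z i) / real (n i)"
        unfolding a_def norm_scaleR by (simp add: divide_inverse)
      also have "\<dots> \<le> D" using D(2)[of "n i" "z i"] npos[of i] by (simp add: divide_le_eq mult.commute)
      finally show ?thesis by simp
    qed
    then obtain l r where r: "strict_mono r" "(a \<circ> r) \<longlonglongrightarrow> l"
      using compact_cball[of "0 :: plane" D] unfolding compact_def by metis
    have "filterlim (\<lambda>i. n (r i)) at_top sequentially"
    proof (rule filterlim_at_top_mono[OF filterlim_ident])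
      show "\<forall>\<^sub>F i in sequentially. i \<le> n (r i)"
        using nz(1) seq_suble[OF r(1)] by (intro always_eventually allI) (meson Suc_leD order_trans)
    qed
    then have "l \<in> rotation_set F"
      unfolding rotation_set_def using r(2) by (auto simp: a_def o_def intro!: exI[of _ "z \<circ> r"] exI[of _ "n \<circ> r"])
    then have "(\<lambda>i. norm ((a \<circ> r) i - \<omega>)) \<longlonglongrightarrow> norm (\<omega> - \<omega>)"
      using r(2) assms(3) by (intro tendsto_intros) (auto simp: o_def)
    then have "\<epsilon> \<le> norm (\<omega> - \<omega>)"
      by (rule tendsto_lowerbound) (use far in \<open>auto intro!: always_eventually less_imp_le\<close>)
    then show False using assms(4) by simp
  qed
  then show ?thesis using that by blast
qed

lemma rotation_set_translate_subset:
  assumes "equivariant F" "u \<in> lattice" "v \<in> rotation_set F"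
  shows "v + u \<in> rotation_set (\<lambda>z. F z + u)"
proof -
  obtain z n where n: "filterlim n at_top sequentially"
    and lim: "(\<lambda>i. ((F ^^ n i) (z i) - z i) /\<^sub>R real (n i)) \<longlonglongrightarrow> v"
    using assms(3) by (auto simp: rotation_set_def)
  have "(\<lambda>i. (((\<lambda>z. F z + u) ^^ n i) (z i) - z i) /\<^sub>R real (n i)) \<longlonglongrightarrow> v + u"
  proof (rule Lim_transform_eventually)
    show "(\<lambda>i. ((F ^^ n i) (z i) - z i) /\<^sub>R real (n i) + u) \<longlonglongrightarrow> v + u"
      by (intro tendsto_intros lim)
    have "\<forall>\<^sub>F i in sequentially. 1 \<le> n i" using n by (simp add: filterlim_at_top)
    then show "\<forall>\<^sub>F i in sequentially. ((F ^^ n i) (z i) - z i) /\<^sub>R real (n i) + u =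
        (((\<lambda>z. F z + u) ^^ n i) (z i) - z i) /\<^sub>R real (n i)"
    proof (eventually_elim)
      case (elim i)
      then have "u = (real (n i) *\<^sub>R u) /\<^sub>R real (n i)" by simp
      then show ?case
        by (simp add: funpow_translate[OF assms(1,2)] scaleR_diff_right scaleR_add_right)
    qed
  qed
  with n show ?thesis unfolding rotation_set_def by blast
qed

lemma rotation_set_translate:
  assumes "equivariant F" "u \<in> lattice" "rotation_set F = {v}"
  shows "rotation_set (\<lambda>z. F z + u) = {v + u}"
proof -
  have e: "equivariant (\<lambda>z. F z + u)"
    using assms(1) by (simp add: equivariant_def algebra_simps)
  have "w + - u \<in> rotation_set F" if "w \<in> rotation_set (\<lambda>z. F z + u)" for w
    using rotation_set_translate_subset[OF e lattice_closed_under(2)[OF assms(2)] that] by simp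
  then have "w = v + u" if "w \<in> rotation_set (\<lambda>z. F z + u)" for w
    using that assms(3) by (metis diff_add_cancel singletonD uminus_add_conv_diff add.commute)
  moreover have "v + u \<in> rotation_set (\<lambda>z. F z + u)"
    using rotation_set_translate_subset[OF assms(1,2)] assms(3) by simp
  ultimately show ?thesis by blast
qed

text \<open>The rotation number fixes the vector only modulo the lattice; a lattice translation of a
  lift adjusts it to the given representative.\<close>

lemma pseudo_rotation_lift:
  assumes "pseudo_rotation f" "rotation_number f = proj \<omega>"
  obtains F where "is_lift F f" "rotation_set F = {\<omega>}"
proof -
  obtain F v where F: "f \<in> Homeo0" "is_lift F f" "rotation_set F = {v}"
    using assms(1) by (auto simp: pseudo_rotation_def)
  define F0 where "F0 = (SOME F. is_lift F f)"
  have F0: "is_lift F0 f" unfolding F0_def by (rule someI[where P = "\<lambda>F. is_lift F f", OF F(2)])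
  have "\<And>z. proj (F0 z) = proj (F z)" by (simp add: is_lift_proj[OF F0] is_lift_proj[OF F(2)])
  then obtain u where u: "u \<in> lattice" "\<And>z. F0 z = F z + u"
    using lifts_differ_by_lattice[OF is_lift_continuous[OF F0] is_lift_continuous[OF F(2)]] by blast
  have e: "equivariant F" using lift_of_Homeo0(1)[OF F(1,2)] .
  have "F0 = (\<lambda>z. F z + u)" using u by blast
  then have "rotation_set F0 = {v + u}" using rotation_set_translate[OF e u(1) F(3)] by simp
  then have "proj \<omega> = proj (v + u)"
    using assms(2) by (simp add: rotation_number_def rotation_vector_def flip: F0_def)
  then have "\<omega> - v \<in> lattice"
    using u(1) by (metis proj_add_lattice proj_eq_iff)
  from is_lift_translate[OF F(2) this] rotation_set_translate[OF e this F(3)]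
  show ?thesis using that by simp
qed

text \<open>Moves a bound known for some lift of \<open>f ^^ l\<close> and some reference vector
  \<rho> to the chosen lift \<open>F\<close> and \<omega>. The two reference motions differ by a
  drift \<open>real n * c\<close> along \<open>e\<close>; one deviation is bounded and the other
  sublinear, so \<open>c = 0\<close>. The remaining \<open>n mod l\<close> steps cost a bounded
  amount.\<close>

lemma bounded_deviation_rotation:
  assumes F: "equivariant F" "continuous_on UNIV F" "is_lift F f" "rotation_set F = {\<omega>}"
    and F1: "is_lift F1 (f ^^ l)" and "1 \<le> l"
    and \<kappa>: "\<And>z n. \<bar>((F1 ^^ n) z - z - real n *\<^sub>R \<rho>) \<bullet> e\<bar> \<le> \<kappa>"
  obtains K where "\<And>z n. \<bar>((F ^^ n) z - z - real n *\<^sub>R \<omega>) \<bullet> e\<bar> \<le> K"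
proof -
  have "0 \<le> \<kappa>" using order_trans[OF abs_ge_zero \<kappa>[of 0 0]] .
  have cl: "continuous_on UNIV (F ^^ l)" by (rule continuous_on_funpow[OF F(2)])
  have "\<And>z. proj (F1 z) = proj ((F ^^ l) z)"
    by (simp add: is_lift_proj[OF F1] is_lift_funpow_proj[OF F(3)])
  then obtain w where w: "w \<in> lattice" "\<And>z. F1 z = (F ^^ l) z + w"
    using lifts_differ_by_lattice[OF is_lift_continuous[OF F1] cl] by blast
  have el: "equivariant (F ^^ l)"
    using equivariant_funpow[OF F(1)] by (simp add: equivariant_def)
  have F1_eq: "F1 = (\<lambda>z. (F ^^ l) z + w)" using w(2) by blast
  have F1n: "(F1 ^^ n) z = (F ^^ (l * n)) z + real n *\<^sub>R w" for n z
    unfolding F1_eq funpow_translate[OF el w(1)] by (simp add: funpow_mult)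
  define c where "c = (real l *\<^sub>R \<omega> + w - \<rho>) \<bullet> e"
  have split: "((F1 ^^ n) z - z - real n *\<^sub>R \<rho>) \<bullet> e =
      ((F ^^ (l * n)) z - z - real (l * n) *\<^sub>R \<omega>) \<bullet> e + real n * c" for n z
    by (simp add: F1n c_def inner_diff_left inner_add_left algebra_simps)
  have "c = 0"
  proof (rule ccontr)
    assume "c \<noteq> 0"
    \<comment> \<open>Chosen so that the sublinear error at time \<open>l * n\<close> is at most
      half the drift; the \<open>+ 1\<close> covers \<open>e = 0\<close>.\<close>
    define \<epsilon> where "\<epsilon> = \<bar>c\<bar> / (2 * real l * (norm e + 1))"
    have "0 < \<epsilon>" using \<open>c \<noteq> 0\<close> assms(6) norm_ge_zero[of e]
      by (auto simp: \<epsilon>_def intro!: divide_pos_pos mult_pos_pos add_nonneg_pos)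
    then obtain N where N: "\<And>n z. n \<ge> N \<Longrightarrow> norm ((F ^^ n) z - z - real n *\<^sub>R \<omega>) \<le> \<epsilon> * real n"
      using rotation_set_singleton_uniform[OF F(1,2,4)] by metis
    obtain n0 :: nat where n0: "2 * \<kappa> / \<bar>c\<bar> < real n0" using reals_Archimedean2 by blast
    define n where "n = max N n0"
    have n: "N \<le> l * n" "2 * \<kappa> / \<bar>c\<bar> < real n"
    proof -
      have "n \<le> l * n" using assms(6) by simp
      then show "N \<le> l * n" by (simp add: n_def)
      show "2 * \<kappa> / \<bar>c\<bar> < real n" using n0 by (simp add: n_def)
    qed
    define X where "X = (F ^^ (l * n)) 0 - 0 - real (l * n) *\<^sub>R \<omega>"
    have "\<bar>real n * c\<bar> \<le> \<kappa> + \<bar>X \<bullet> e\<bar>"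
      using \<kappa>[of n 0] unfolding split X_def by linarith
    also have "\<bar>X \<bullet> e\<bar> \<le> norm X * norm e" by (rule Cauchy_Schwarz_ineq2)
    also have "\<dots> \<le> (\<epsilon> * real (l * n)) * (norm e + 1)"
      using N[OF n(1), of 0] \<open>0 < \<epsilon>\<close> unfolding X_def by (intro mult_mono) auto
    also have "\<dots> = real n * \<bar>c\<bar> / 2"
    proof -
      obtain b where b: "b = norm e + 1" "b \<noteq> 0" using norm_ge_zero[of e] by force
      then show ?thesis using assms(6) unfolding \<epsilon>_def b(1)[symmetric] by simp
    qed
    finally have "real n * \<bar>c\<bar> / 2 \<le> \<kappa>" by (simp add: abs_mult)
    moreover have "\<kappa> < real n * \<bar>c\<bar> / 2" using n(2) \<open>c \<noteq> 0\<close> by (simp add: field_simps)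
    ultimately show False by simp
  qed
  obtain D where D: "0 \<le> D" "\<And>z n. norm ((F ^^ n) z - z) \<le> real n * D"
    using equivariant_displacement_bounded[OF F(1,2)] by blast
  have "\<bar>((F ^^ n) z - z - real n *\<^sub>R \<omega>) \<bullet> e\<bar> \<le> \<kappa> + real l * (D + norm \<omega>) * norm e" for z n
  proof -
    define j where "j = n mod l"
    define k where "k = n div l"
    have n: "n = l * k + j" by (simp add: j_def k_def)
    have "j \<le> l" using assms(6) by (simp add: j_def less_imp_le)
    define z' where "z' = (F ^^ j) z"
    have "(F ^^ n) z = (F ^^ (l * k)) z'" by (simp add: n z'_def funpow_add)
    then have "((F ^^ n) z - z - real n *\<^sub>R \<omega>) \<bullet> e =
        ((F ^^ (l * k)) z' - z' - real (l * k) *\<^sub>R \<omega>) \<bullet> e + (z' - z - real j *\<^sub>R \<omega>) \<bullet> e"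
      by (simp add: n inner_diff_left inner_add_left algebra_simps)
    moreover have "\<bar>((F ^^ (l * k)) z' - z' - real (l * k) *\<^sub>R \<omega>) \<bullet> e\<bar> \<le> \<kappa>"
      using \<kappa>[of k z'] split[of k z'] \<open>c = 0\<close> by simp
    moreover have "\<bar>(z' - z - real j *\<^sub>R \<omega>) \<bullet> e\<bar> \<le> real l * (D + norm \<omega>) * norm e"
    proof -
      have "\<bar>(z' - z - real j *\<^sub>R \<omega>) \<bullet> e\<bar> \<le> norm (z' - z - real j *\<^sub>R \<omega>) * norm e"
        by (rule Cauchy_Schwarz_ineq2)
      also have "norm (z' - z - real j *\<^sub>R \<omega>) \<le> real j * D + real j * norm \<omega>"
        using norm_triangle_ineq4[of "z' - z" "real j *\<^sub>R \<omega>"] D(2)[of j z] by (simp add: z'_def)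
      also have "\<dots> \<le> real l * (D + norm \<omega>)"
        using \<open>j \<le> l\<close> D(1) by (simp add: distrib_left add_mono mult_right_mono)
      finally show ?thesis by (simp add: mult_right_mono)
    qed
    ultimately show ?thesis by linarith
  qed
  then show ?thesis using that by blast
qed

section \<open>Lattice translates met by an orbit\<close>

lemma card_int_interval:
  fixes s A :: real
  assumes "0 \<le> A"
  shows "finite {m :: int. \<bar>real_of_int m - s\<bar> \<le> A}"
    and "real (card {m :: int. \<bar>real_of_int m - s\<bar> \<le> A}) \<le> 2 * A + 1"
proof -
  have eq: "{m :: int. \<bar>real_of_int m - s\<bar> \<le> A} = {\<lceil>s - A\<rceil>..\<lfloor>s + A\<rfloor>}"
    by (auto simp: abs_le_iff ceiling_le_iff le_floor_iff algebra_simps)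
  then show "finite {m :: int. \<bar>real_of_int m - s\<bar> \<le> A}" by simp
  have "real_of_int (\<lfloor>s + A\<rfloor> - \<lceil>s - A\<rceil> + 1) \<le> 2 * A + 1"
    using of_int_floor_le[of "s + A"] le_of_int_ceiling[of "s - A"] by linarith
  then show "real (card {m :: int. \<bar>real_of_int m - s\<bar> \<le> A}) \<le> 2 * A + 1"
    unfolding eq using assms by (cases "0 \<le> \<lfloor>s + A\<rfloor> - \<lceil>s - A\<rceil> + 1") (auto simp: nat_eq_iff2)
qed

text \<open>The inner products with \<open>(c, d)\<close> and \<open>(d, - c)\<close> are integers
  and determine \<open>v\<close>, the determinant being \<open>- (c\<^sup>2 + d\<^sup>2)\<close>.
  This embeds the set into a product of two integer intervals.\<close>

lemma card_lattice_rectangle: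
  fixes c d :: int and A B :: real and y :: plane
  assumes "(c, d) \<noteq> (0, 0)" "0 \<le> A" "0 \<le> B"
  defines "V \<equiv> {v \<in> lattice. \<bar>(v - y) \<bullet> (of_int c, of_int d)\<bar> \<le> A \<and> \<bar>(v - y) \<bullet> (of_int d, - of_int c)\<bar> \<le> B}"
  shows "finite V" and "real (card V) \<le> (2 * A + 1) * (2 * B + 1)"
proof -
  define e1 e2 :: plane where "e1 = (of_int c, of_int d)" and "e2 = (of_int d, - of_int c)"
  define S T where "S = {m :: int. \<bar>real_of_int m - y \<bullet> e1\<bar> \<le> A}"
    and "T = {m :: int. \<bar>real_of_int m - y \<bullet> e2\<bar> \<le> B}"
  define \<phi> where "\<phi> v = (\<lfloor>v \<bullet> e1\<rfloor>, \<lfloor>v \<bullet> e2\<rfloor>)" for v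
  have int: "of_int \<lfloor>v \<bullet> e1\<rfloor> = v \<bullet> e1" "of_int \<lfloor>v \<bullet> e2\<rfloor> = v \<bullet> e2" if "v \<in> lattice" for v
  proof -
    have *: "of_int \<lfloor>x\<rfloor> = x" if "x \<in> \<int>" for x :: real using that by (auto elim: Ints_cases)
    show "of_int \<lfloor>v \<bullet> e1\<rfloor> = v \<bullet> e1" "of_int \<lfloor>v \<bullet> e2\<rfloor> = v \<bullet> e2"
      by (rule *; use that in \<open>auto simp: lattice_def e1_def e2_def inner_prod_def\<close>)+
  qed
  have "inj_on \<phi> V"
  proof (rule inj_onI)
    fix v w assume "v \<in> V" "w \<in> V" "\<phi> v = \<phi> w"
    then have L: "v \<in> lattice" "w \<in> lattice"
      and eq: "\<lfloor>v \<bullet> e1\<rfloor> = \<lfloor>w \<bullet> e1\<rfloor>" "\<lfloor>v \<bullet> e2\<rfloor> = \<lfloor>w \<bullet> e2\<rfloor>"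
      by (auto simp: \<phi>_def V_def)
    have "v \<bullet> e1 = w \<bullet> e1" "v \<bullet> e2 = w \<bullet> e2"
      using int(1)[OF L(1)] int(1)[OF L(2)] int(2)[OF L(1)] int(2)[OF L(2)] eq by linarith+
    then have eq: "c * (fst v - fst w) + d * (snd v - snd w) = 0" "d * (fst v - fst w) - c * (snd v - snd w) = 0"
      by (auto simp: e1_def e2_def inner_prod_def algebra_simps)
    define X Y where "X = fst v - fst w" and "Y = snd v - snd w"
    have "(real_of_int c ^ 2 + real_of_int d ^ 2) * X = 0" "(real_of_int c ^ 2 + real_of_int d ^ 2) * Y = 0"
      using eq unfolding X_def[symmetric] Y_def[symmetric] by algebra+
    moreover have "real_of_int c ^ 2 + real_of_int d ^ 2 \<noteq> 0"
      using assms(1) by (auto simp: sum_power2_eq_zero_iff)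
    ultimately show "v = w" by (auto simp: X_def Y_def prod_eq_iff)
  qed
  moreover have sub: "\<phi> ` V \<subseteq> S \<times> T"
    by (auto simp: \<phi>_def V_def S_def T_def int inner_diff_left e1_def[symmetric] e2_def[symmetric])
  moreover have ST: "finite S" "finite T" "real (card S) \<le> 2 * A + 1" "real (card T) \<le> 2 * B + 1"
    unfolding S_def T_def using card_int_interval assms(2,3) by auto
  ultimately show "finite V" by (meson finite_SigmaI finite_imageD finite_subset)
  have "card V \<le> card (S \<times> T)"
    using card_mono[OF _ sub] card_image[OF \<open>inj_on \<phi> V\<close>] ST by simp
  then have "real (card V) \<le> real (card S) * real (card T)"
    by (simp add: card_cartesian_product flip: of_nat_mult)
  also have "\<dots> \<le> (2 * A + 1) * (2 * B + 1)"
    using ST by (intro mult_mono) auto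
  finally show "real (card V) \<le> (2 * A + 1) * (2 * B + 1)" .
qed

text \<open>For equivariant \<open>F\<close> and \<open>p\<close> in the lattice, the point tested
  is the \<open>i\<close>-th iterate of \<open>z\<close> under \<open>G\<close>, so these are the
  translates of a disc about \<open>x\<close> met before time \<open>J\<close>. Radius 1, in place
  of some \<open>r \<le> 1\<close>, frees the count from the size of the disc.\<close>

definition labels :: "(plane \<Rightarrow> plane) \<Rightarrow> nat \<Rightarrow> plane \<Rightarrow> nat \<Rightarrow> plane \<Rightarrow> plane \<Rightarrow> plane set" where
  "labels F q p J x z =
     {v \<in> lattice. \<exists>i<J. norm ((F ^^ (q * i)) z - real i *\<^sub>R p - x - v) < 1}"

text \<open>The constant \<open>C\<close> must not depend on \<open>q\<close>, whereas the time horizon \<open>J\<close> may.\<close>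

definition few_labels :: "(plane \<Rightarrow> plane) \<Rightarrow> plane \<Rightarrow> bool" where
  "few_labels F \<omega> \<longleftrightarrow> (\<exists>C>0. \<exists>\<delta>0>0. \<forall>q\<ge>1. \<forall>p\<in>lattice.
     0 < norm (real q *\<^sub>R \<omega> - p) \<longrightarrow> norm (real q *\<^sub>R \<omega> - p) < \<delta>0 \<longrightarrow>
     (\<exists>J. \<forall>x z. finite (labels F q p J x z) \<and>
        real (card (labels F q p J x z)) < C * norm (real q *\<^sub>R \<omega> - p) * real J))"

text \<open>A label differs from \<open>z - x\<close> by the deviation of \<open>F\<close>, the
  drift of \<open>i\<close> steps of \<open>real q *\<^sub>R \<omega> - p\<close>, and an error
  shorter than 1.\<close>

lemma labels_inner:
  assumes "v \<in> labels F q p J x z"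
  obtains i where "i < J"
    "\<bar>(v - (z - x)) \<bullet> e\<bar> \<le> \<bar>((F ^^ (q * i)) z - z - real (q * i) *\<^sub>R \<omega>) \<bullet> e\<bar>
        + real i * \<bar>(real q *\<^sub>R \<omega> - p) \<bullet> e\<bar> + norm e"
proof -
  obtain i where i: "i < J" "norm ((F ^^ (q * i)) z - real i *\<^sub>R p - x - v) < 1"
    using assms by (auto simp: labels_def)
  define X where "X = (F ^^ (q * i)) z - z - real (q * i) *\<^sub>R \<omega>"
  define E where "E = (F ^^ (q * i)) z - real i *\<^sub>R p - x - v"
  have "(v - (z - x)) \<bullet> e = X \<bullet> e + real i * ((real q *\<^sub>R \<omega> - p) \<bullet> e) - E \<bullet> e"
    by (simp add: X_def E_def inner_diff_left inner_add_left algebra_simps)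
  then have "\<bar>(v - (z - x)) \<bullet> e\<bar> \<le> \<bar>X \<bullet> e\<bar> + \<bar>real i * ((real q *\<^sub>R \<omega> - p) \<bullet> e)\<bar> + \<bar>E \<bullet> e\<bar>"
    by linarith
  moreover have "\<bar>E \<bullet> e\<bar> \<le> 1 * norm e"
    using i(2) by (intro order_trans[OF Cauchy_Schwarz_ineq2] mult_right_mono) (auto simp: E_def)
  ultimately have "\<bar>(v - (z - x)) \<bullet> e\<bar> \<le> \<bar>X \<bullet> e\<bar> + real i * \<bar>(real q *\<^sub>R \<omega> - p) \<bullet> e\<bar> + norm e"
    by (simp add: abs_mult)
  with i(1) show ?thesis using that unfolding X_def by blast
qed

lemma few_labels_bounded_mean_motion:
  assumes K: "\<And>z n. norm ((F ^^ n) z - z - real n *\<^sub>R \<omega>) \<le> K"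
  shows "few_labels F \<omega>"
proof -
  have "0 \<le> K" using order_trans[OF norm_ge_zero K[of 0 0]] .
  \<comment> \<open>\<open>A\<close> allows \<open>K\<close> for the deviation, 1 for the drift
    before time \<open>J\<close> and 1 for the radius of the disc. In \<open>C\<close> the factor 2
    compensates \<open>1 / 2 \<le> \<delta> * real J\<close>, and the inner summand 1 makes the
    final inequality strict.\<close>
  define A where "A = K + 2"
  define C where "C = 2 * ((2 * A + 1) * (2 * A + 1) + 1)"
  have A: "0 \<le> A" using \<open>0 \<le> K\<close> by (simp add: A_def)
  then have C: "0 < C" unfolding C_def by (intro mult_pos_pos add_nonneg_pos mult_nonneg_nonneg) auto
  show ?thesis
    unfolding few_labels_def
  proof (rule exI[of _ C], intro conjI exI[of _ "1/2 :: real"] allI impI ballI)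
    fix q :: nat and p
    define \<delta> where "\<delta> = norm (real q *\<^sub>R \<omega> - p)"
    assume "0 < norm (real q *\<^sub>R \<omega> - p)" "norm (real q *\<^sub>R \<omega> - p) < 1 / 2"
    then have \<delta>: "0 < \<delta>" "\<delta> < 1 / 2" by (auto simp: \<delta>_def)
    \<comment> \<open>Long enough that \<open>\<delta> * real J\<close> is at least
      \<open>1 / 2\<close>, short enough that the total drift is at most 1.\<close>
    define J where "J = nat \<lfloor>1 / \<delta>\<rfloor>"
    have "2 \<le> 1 / \<delta>" using \<delta> by (simp add: field_simps)
    then have J: "real J \<le> 1 / \<delta>" "1 / \<delta> < real J + 1"
      unfolding J_def by linarith+
    have J\<delta>: "real J * \<delta> \<le> 1" "1 / 2 \<le> \<delta> * real J"
      using J \<delta> by (auto simp: field_simps)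
    have fin: "finite (labels F q p J x z) \<and> real (card (labels F q p J x z)) < C * \<delta> * real J" for x z
    proof -
      define V where "V = {v \<in> lattice. \<bar>(v - (z - x)) \<bullet> (of_int 1, of_int 0)\<bar> \<le> A \<and>
        \<bar>(v - (z - x)) \<bullet> (of_int 0, - of_int 1)\<bar> \<le> A}"
      have V: "finite V" "real (card V) \<le> (2 * A + 1) * (2 * A + 1)"
        unfolding V_def by (rule card_lattice_rectangle; use A in simp)+
      have bound: "\<bar>(v - (z - x)) \<bullet> e\<bar> \<le> A" if v: "v \<in> labels F q p J x z" and e: "norm e = 1" for v e
      proof -
        obtain i where i: "i < J" "\<bar>(v - (z - x)) \<bullet> e\<bar> \<le> \<bar>((F ^^ (q * i)) z - z - real (q * i) *\<^sub>R \<omega>) \<bullet> e\<bar>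
          + real i * \<bar>(real q *\<^sub>R \<omega> - p) \<bullet> e\<bar> + norm e"
          using labels_inner[OF v] by blast
        note i(2)
        also have "\<bar>((F ^^ (q * i)) z - z - real (q * i) *\<^sub>R \<omega>) \<bullet> e\<bar> \<le> K"
          using Cauchy_Schwarz_ineq2[of "(F ^^ (q * i)) z - z - real (q * i) *\<^sub>R \<omega>" e] K[of "q * i" z] e by simp
        also have "real i * \<bar>(real q *\<^sub>R \<omega> - p) \<bullet> e\<bar> \<le> real J * \<delta>"
          using Cauchy_Schwarz_ineq2[of "real q *\<^sub>R \<omega> - p" e] i(1) e
          by (intro mult_mono) (auto simp: \<delta>_def)
        finally show ?thesis using J\<delta> e by (simp add: A_def)
      qed
      have sub: "labels F q p J x z \<subseteq> V"
      proof
        fix v assume v: "v \<in> labels F q p J x z"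
        show "v \<in> V"
          using bound[OF v, of "(of_int 1, of_int 0)"] bound[OF v, of "(of_int 0, - of_int 1)"] v
          by (simp add: V_def norm_Pair labels_def)
      qed
      have "real (card (labels F q p J x z)) \<le> (2 * A + 1) * (2 * A + 1)"
        using card_mono[OF V(1) sub] V(2) by linarith
      also have "\<dots> < C * (1 / 2)" by (simp add: C_def)
      also have "\<dots> \<le> C * (\<delta> * real J)" using C J\<delta> by (intro mult_left_mono) auto
      finally show ?thesis using finite_subset[OF sub V(1)] by (simp add: mult.assoc)
    qed
    show "\<exists>J. \<forall>x z. finite (labels F q p J x z) \<and>
        real (card (labels F q p J x z)) < C * norm (real q *\<^sub>R \<omega> - p) * real J"
      using fin unfolding \<delta>_def by blast
  qed (use C in auto)
qed

text \<open>The inner product of \<open>real q *\<^sub>R \<omega> - p\<close> with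
  \<open>(c, d)\<close> is an integer multiple of \<open>1 / t\<close>, so it vanishes once the
  vector is short: the drift is entirely along \<open>(d, - c)\<close>. The labels then lie in a
  strip of bounded width, whose relevant length is linear in \<open>\<delta> * real J\<close> up to
  an additive constant.\<close>

lemma few_labels_bounded_deviation:
  fixes c d :: int
  assumes F: "equivariant F" "continuous_on UNIV F" "rotation_set F = {\<omega>}"
    and cd: "(c, d) \<noteq> (0, 0)" "of_int c * fst \<omega> + of_int d * snd \<omega> \<in> \<rat>"
    and K: "\<And>z n. \<bar>((F ^^ n) z - z - real n *\<^sub>R \<omega>) \<bullet> (of_int c, of_int d)\<bar> \<le> K"
  shows "few_labels F \<omega>"
proof -
  define e1 e2 :: plane where "e1 = (of_int c, of_int d)" and "e2 = (of_int d, - of_int c)"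
  define b where "b = norm e1"
  have b: "norm e1 = b" "norm e2 = b" "0 \<le> b"
    by (auto simp: b_def e1_def e2_def norm_Pair add.commute)
  have "0 \<le> K" using order_trans[OF abs_ge_zero K[of 0 0]] .
  obtain s t :: int where st: "0 < t" "\<omega> \<bullet> e1 = of_int s / of_int t"
    using Rats_cases'[OF cd(2)] by (metis e1_def inner_commute inner_prod_def inner_real_def fst_conv snd_conv)
  obtain D where D: "0 \<le> D" "\<And>z n. norm ((F ^^ n) z - z) \<le> real n * D"
    using equivariant_displacement_bounded[OF F(1,2)] by blast
  define A where "A = K + b"
  define C where "C = (2 * A + 1) * (4 * b + 1)"
  define \<delta>0 where "\<delta>0 = 1 / (of_int t * (b + 1))"
  have A: "0 \<le> A" and C: "0 < C" and \<delta>0: "0 < \<delta>0"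
    using \<open>0 \<le> K\<close> b st by (auto simp: A_def C_def \<delta>0_def intro!: mult_pos_pos divide_pos_pos)
  show ?thesis
    unfolding few_labels_def
  proof (rule exI[of _ C], intro conjI exI[of _ \<delta>0] allI impI ballI)
    fix q :: nat and p
    assume "1 \<le> q" and p: "p \<in> lattice"
    define \<delta> where "\<delta> = norm (real q *\<^sub>R \<omega> - p)"
    assume "0 < norm (real q *\<^sub>R \<omega> - p)" "norm (real q *\<^sub>R \<omega> - p) < \<delta>0"
    then have \<delta>: "0 < \<delta>" "\<delta> < \<delta>0" by (auto simp: \<delta>_def)
    have zero: "(real q *\<^sub>R \<omega> - p) \<bullet> e1 = 0"
    proof -
      define Y where "Y = of_int t * ((real q *\<^sub>R \<omega> - p) \<bullet> e1)"
      have "p \<bullet> e1 \<in> \<int>" using p by (auto simp: lattice_def e1_def inner_prod_def)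
      then have "real q * of_int s - of_int t * (p \<bullet> e1) \<in> \<int>" by simp
      moreover have "Y = real q * of_int s - of_int t * (p \<bullet> e1)"
        using st by (simp add: Y_def inner_diff_left right_diff_distrib)
      ultimately have "Y \<in> \<int>" by simp
      moreover have "\<bar>Y\<bar> < 1"
      proof -
        have "\<bar>Y\<bar> \<le> of_int t * (\<delta> * b)"
          using Cauchy_Schwarz_ineq2[of "real q *\<^sub>R \<omega> - p" e1] st
          by (simp add: Y_def abs_mult \<delta>_def b)
        also have "\<dots> \<le> of_int t * (\<delta> * (b + 1))" using \<delta> st by (intro mult_left_mono) auto
        also have "\<dots> < of_int t * (\<delta>0 * (b + 1))"
          using \<delta> st b by (intro mult_strict_left_mono mult_strict_right_mono) auto
        also have "\<dots> = 1"
        proof -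
          have "b + 1 \<noteq> 0" using b by linarith
          then show ?thesis using st by (simp add: \<delta>0_def)
        qed
        finally show ?thesis .
      qed
      ultimately have "Y = 0" using Ints_nonzero_abs_ge1 by force
      then show ?thesis using st by (simp add: Y_def)
    qed
    \<comment> \<open>Accuracy \<open>\<delta> / real q\<close> per iterate of \<open>F\<close>
      amounts to \<delta> per block of \<open>q\<close> iterates, the same order as the
      drift.\<close>
    have "0 < \<delta> / real q" using \<delta> \<open>1 \<le> q\<close> by simp
    then obtain N where N: "\<And>n z. n \<ge> N \<Longrightarrow> norm ((F ^^ n) z - z - real n *\<^sub>R \<omega>) \<le> \<delta> / real q * real n"
      using rotation_set_singleton_uniform[OF F] by metis
    \<comment> \<open>Covers the times before \<open>N\<close>. It depends on \<open>q\<close>, so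
      it must be absorbed by \<open>J\<close> and not by \<open>C\<close>.\<close>
    define M where "M = real N * (D + norm \<omega>)"
    have M: "0 \<le> M" using D by (simp add: M_def)
    have dev: "norm ((F ^^ n) z - z - real n *\<^sub>R \<omega>) \<le> \<delta> / real q * real n + M" for n z
    proof (cases "N \<le> n")
      case True then show ?thesis using N[OF True, of z] M by linarith
    next
      case False
      have "norm ((F ^^ n) z - z - real n *\<^sub>R \<omega>) \<le> real n * D + real n * norm \<omega>"
        using norm_triangle_ineq4[of "(F ^^ n) z - z" "real n *\<^sub>R \<omega>"] D(2)[of n z] by simp
      also have "\<dots> \<le> M"
        using False D unfolding M_def distrib_left by (intro add_mono mult_right_mono) auto
      finally show ?thesis using \<delta> by (simp add: add_increasing)
    qed
    obtain J :: nat where "(2 * (b * (M + 1)) + 1) / \<delta> < real J" using reals_Archimedean2 by blast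
    then have J: "2 * (b * (M + 1)) + 1 < \<delta> * real J" using \<delta> by (simp add: field_simps)
    \<comment> \<open>One \<open>\<delta> * real J\<close> accounts for the drift, the other for the
      deviation.\<close>
    define B where "B = b * (2 * (\<delta> * real J) + M + 1)"
    have B: "0 \<le> B" using b \<delta> M by (simp add: B_def)
    have fin: "finite (labels F q p J x z) \<and> real (card (labels F q p J x z)) < C * \<delta> * real J" for x z
    proof -
      define V where "V = {v \<in> lattice. \<bar>(v - (z - x)) \<bullet> (of_int c, of_int d)\<bar> \<le> A \<and>
        \<bar>(v - (z - x)) \<bullet> (of_int d, - of_int c)\<bar> \<le> B}"
      have V: "finite V" "real (card V) \<le> (2 * A + 1) * (2 * B + 1)"
        unfolding V_def using card_lattice_rectangle[OF cd(1) A B] by auto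
      have sub: "labels F q p J x z \<subseteq> V"
      proof
        fix v assume v: "v \<in> labels F q p J x z"
        obtain i where i: "i < J" "\<bar>(v - (z - x)) \<bullet> e1\<bar> \<le> \<bar>((F ^^ (q * i)) z - z - real (q * i) *\<^sub>R \<omega>) \<bullet> e1\<bar>
          + real i * \<bar>(real q *\<^sub>R \<omega> - p) \<bullet> e1\<bar> + norm e1"
          using labels_inner[OF v] by blast
        have 1: "\<bar>(v - (z - x)) \<bullet> e1\<bar> \<le> A"
          using i(2) K[of "q * i" z] by (simp add: zero A_def b flip: e1_def)
        obtain i where i: "i < J" "\<bar>(v - (z - x)) \<bullet> e2\<bar> \<le> \<bar>((F ^^ (q * i)) z - z - real (q * i) *\<^sub>R \<omega>) \<bullet> e2\<bar>
          + real i * \<bar>(real q *\<^sub>R \<omega> - p) \<bullet> e2\<bar> + norm e2"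
          using labels_inner[OF v] by blast
        note i(2)
        also have "\<bar>((F ^^ (q * i)) z - z - real (q * i) *\<^sub>R \<omega>) \<bullet> e2\<bar> \<le> (\<delta> * real J + M) * b"
        proof -
          have "\<delta> / real q * real (q * i) = \<delta> * real i" using \<open>1 \<le> q\<close> by simp
          also have "\<dots> \<le> \<delta> * real J" using i(1) \<delta> by (intro mult_left_mono) auto
          finally have "norm ((F ^^ (q * i)) z - z - real (q * i) *\<^sub>R \<omega>) \<le> \<delta> * real J + M"
            using dev[of "q * i" z] by linarith
          then show ?thesis
            using b by (intro order_trans[OF Cauchy_Schwarz_ineq2]) (simp add: mult_right_mono)
        qed
        also have "real i * \<bar>(real q *\<^sub>R \<omega> - p) \<bullet> e2\<bar> \<le> real J * (\<delta> * b)"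
          using Cauchy_Schwarz_ineq2[of "real q *\<^sub>R \<omega> - p" e2] i(1) b
          by (intro mult_mono) (auto simp: \<delta>_def)
        also have "(\<delta> * real J + M) * b + real J * (\<delta> * b) + norm e2 = B"
          by (simp add: B_def b algebra_simps)
        finally have 2: "\<bar>(v - (z - x)) \<bullet> e2\<bar> \<le> B" by simp
        from 1 2 v show "v \<in> V" by (simp add: V_def labels_def e1_def e2_def)
      qed
      have "real (card (labels F q p J x z)) \<le> (2 * A + 1) * (2 * B + 1)"
        using card_mono[OF V(1) sub] V(2) by linarith
      also have "2 * B + 1 = 4 * b * (\<delta> * real J) + (2 * (b * (M + 1)) + 1)"
        by (simp add: B_def algebra_simps)
      also have "(2 * A + 1) * \<dots> < (2 * A + 1) * (4 * b * (\<delta> * real J) + \<delta> * real J)"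
        using J A by (intro mult_strict_left_mono) auto
      also have "\<dots> = C * \<delta> * real J" by (simp add: C_def algebra_simps)
      finally show ?thesis using finite_subset[OF sub V(1)] by simp
    qed
    show "\<exists>J. \<forall>x z. finite (labels F q p J x z) \<and>
        real (card (labels F q p J x z)) < C * norm (real q *\<^sub>R \<omega> - p) * real J"
      using fin unfolding \<delta>_def by blast
  qed (use C \<delta>0 in auto)
qed

section \<open>Recurrence and rigidity\<close>

lemma measure_preserving_funpow:
  assumes "g \<in> measurable M M" "distr M M g = M"
  shows "g ^^ i \<in> measurable M M" "distr M M (g ^^ i) = M"
proof (induction i)
  case (Suc i)
  { case 1 show ?case using Suc(1) assms(1) by (simp add: measurable_comp) }
  { case 2
    have "distr M M (g \<circ> (g ^^ i)) = distr (distr M M (g ^^ i)) M g"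
      by (rule distr_distr[symmetric, OF assms(1) Suc(1)])
    then have "distr M M (g \<circ> (g ^^ i)) = M" using Suc(2) assms(2) by simp
    then show ?case by (simp only: funpow.simps) }
qed (simp_all add: id_def distr_id)

text \<open>By invariance the number of visits has mean \<open>real J * measure M A\<close>, and
  some point reaches the mean.\<close>

lemma (in finite_measure) measure_preserving_many_visits:
  assumes g: "g \<in> measurable M M" "distr M M g = M" and A: "A \<in> sets M"
    and "measure M (space M) = 1"
  obtains x where "x \<in> space M" "real J * measure M A \<le> real (card {i. i < J \<and> (g ^^ i) x \<in> A})"
proof (rule ccontr)
  assume "\<not> thesis"
  with that have less: "real (card {i. i < J \<and> (g ^^ i) x \<in> A}) < real J * measure M A" if "x \<in> space M" for x
    using that by (meson not_le)
  note m = measure_preserving_funpow(1)[OF g] and d = measure_preserving_funpow(2)[OF g]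
  \<comment> \<open>The largest integer below the mean. If all counts were below the mean,
    integrality would bound them uniformly by \<open>k\<close>, and so would the mean be.\<close>
  define k where "k = \<lceil>real J * measure M A\<rceil> - 1"
  have setm: "(g ^^ i) -` A \<inter> space M \<in> sets M" for i using m A by (rule measurable_sets)
  have meas: "measure M ((g ^^ i) -` A \<inter> space M) = measure M A" for i
    using measure_distr[OF m A, of i] d[of i] by simp
  have card_eq: "real (card {i. i < J \<and> (g ^^ i) x \<in> A}) = (\<Sum>i<J. indicator ((g ^^ i) -` A \<inter> space M) x)"
    if "x \<in> space M" for x
  proof -
    have "(\<Sum>i<J. indicator ((g ^^ i) -` A \<inter> space M) x) = (\<Sum>i<J. if (g ^^ i) x \<in> A then 1 else 0 :: real)"
      using that by (intro sum.cong) (auto simp: indicator_def)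
    also have "\<dots> = real (card ({..<J} \<inter> {i. (g ^^ i) x \<in> A}))" by (simp add: sum.If_cases)
    also have "{..<J} \<inter> {i. (g ^^ i) x \<in> A} = {i. i < J \<and> (g ^^ i) x \<in> A}" by auto
    finally show ?thesis by simp
  qed
  have "(\<integral>x. (\<Sum>i<J. indicator ((g ^^ i) -` A \<inter> space M) x) \<partial>M) = (\<Sum>i<J. measure M A :: real)"
    using setm meas by (subst Bochner_Integration.integral_sum) (auto simp: less_top[symmetric])
  moreover have "(\<integral>x. (\<Sum>i<J. indicator ((g ^^ i) -` A \<inter> space M) x :: real) \<partial>M) \<le> (\<integral>x. of_int k \<partial>M)"
  proof (rule integral_mono)
    show "integrable M (\<lambda>x. \<Sum>i<J. indicator ((g ^^ i) -` A \<inter> space M) x :: real)"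
      using setm by (intro Bochner_Integration.integrable_sum) (auto simp: less_top[symmetric])
    fix x assume x: "x \<in> space M"
    have "int (card {i. i < J \<and> (g ^^ i) x \<in> A}) \<le> k"
      using less[OF x] unfolding k_def by linarith
    then have "real (card {i. i < J \<and> (g ^^ i) x \<in> A}) \<le> of_int k"
      by (metis of_int_le_iff of_int_of_nat_eq)
    then show "(\<Sum>i<J. indicator ((g ^^ i) -` A \<inter> space M) x) \<le> real_of_int k"
      using card_eq[OF x] by simp
  qed simp
  ultimately have "real J * measure M A \<le> of_int k" using assms(4) by simp
  then show False unfolding k_def by linarith
qed

section \<open>Area of discs on the torus\<close>

lemma space_torus_lebesgue [simp]: "space torus_lebesgue = UNIV"
  by (simp add: torus_lebesgue_def)

lemma sets_torus_lebesgue [simp]: "sets torus_lebesgue = sets borel"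
  by (simp add: torus_lebesgue_def)

lemma emeasure_lborel_rectangle:
  fixes I J :: "real set"
  assumes "I \<in> sets borel" "J \<in> sets borel"
  shows "emeasure lborel (I \<times> J) = emeasure lborel I * emeasure lborel J"
  using assms unfolding lborel_prod[symmetric] by (intro lborel.emeasure_pair_measure_Times) auto

lemma emeasure_torus_lebesgue_UNIV: "emeasure torus_lebesgue UNIV = 1"
  by (simp add: emeasure_torus_lebesgue emeasure_lborel_rectangle)

lemma finite_measure_torus_lebesgue: "finite_measure torus_lebesgue"
  by (rule finite_measureI) (simp add: emeasure_torus_lebesgue_UNIV)

lemma mem_torus_ball:
  "proj w \<in> ball (proj x) r \<longleftrightarrow> (\<exists>v\<in>lattice. norm (w - x - v) < r)"
proof
  assume "proj w \<in> ball (proj x) r"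
  then have "torus_norm (w - x) < r" by (simp add: dist_commute flip: dist_proj)
  then show "\<exists>v\<in>lattice. norm (w - x - v) < r" by (metis torus_norm_attained)
next
  assume "\<exists>v\<in>lattice. norm (w - x - v) < r"
  then have "torus_norm (w - x) < r" using torus_norm_le le_less_trans by blast
  then show "proj w \<in> ball (proj x) r" by (simp add: dist_commute flip: dist_proj)
qed

lemma measure_torus_ball_ge:
  assumes "0 < r" "r \<le> 1"
  shows "r\<^sup>2 / 16 \<le> measure torus_lebesgue (ball \<xi> r)"
proof -
  obtain x0 where x0: "proj x0 = \<xi>" by (rule proj_surj)
  define x where "x = (frac (fst x0), frac (snd x0))"
  have "x0 - x \<in> lattice" by (cases x0) (auto simp: x_def lattice_def frac_def)
  then have x: "proj x = \<xi>" using x0 by (metis proj_eq_iff)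
  \<comment> \<open>The interval points away from the nearer end of the unit interval, so the square
    built from two of these stays in the fundamental domain; its points are within
    \<open>r / 2\<close> of \<open>x\<close>.\<close>
  define I where "I s = (if s < 1/2 then {s..s + r/4} else {s - r/4..s})" for s :: real
  have I: "I s \<in> sets borel" "emeasure lborel (I s) = ennreal (r / 4)" for s
    using assms by (auto simp: I_def)
  have I_sub: "y \<in> {0..<1}" "\<bar>y - s\<bar> \<le> r / 4" if "y \<in> I s" "0 \<le> s" "s < 1" for y s
    using that assms by (auto simp: I_def split: if_splits)
  have "I (fst x) \<times> I (snd x) \<subseteq> proj -` ball \<xi> r \<inter> {0..<1} \<times> {0..<1}"
  proof
    fix w assume w: "w \<in> I (fst x) \<times> I (snd x)"
    have fr: "0 \<le> fst x" "fst x < 1" "0 \<le> snd x" "snd x < 1" by (auto simp: x_def frac_lt_1)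
    have "norm (w - x) \<le> \<bar>fst w - fst x\<bar> + \<bar>snd w - snd x\<bar>"
      using norm_Pair_le[of "fst w - fst x" "snd w - snd x"] by (simp add: minus_prod_def)
    also have "\<dots> \<le> r / 4 + r / 4" using w I_sub fr by (intro add_mono) (auto simp: mem_Times_iff)
    also have "\<dots> < r" using assms by simp
    finally have "norm (w - x - 0) < r" by simp
    then have "proj w \<in> ball \<xi> r" unfolding x[symmetric] mem_torus_ball
      using lattice_closed_under(1) by blast
    moreover have "w \<in> {0..<1} \<times> {0..<1}" using w I_sub(1) fr by (auto simp: mem_Times_iff)
    ultimately show "w \<in> proj -` ball \<xi> r \<inter> {0..<1} \<times> {0..<1}" by simp
  qed
  moreover have "proj -` ball \<xi> r \<inter> {0..<1} \<times> {0..<1} \<in> sets borel"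
  proof -
    have "open (proj -` ball \<xi> r)" by (simp flip: open_torus_iff)
    moreover have "({0..<1} \<times> {0..<1} :: plane set) \<in> sets borel" by (intro borel_Times) auto
    ultimately show ?thesis by (simp add: borel_open)
  qed
  ultimately have "emeasure lborel (I (fst x) \<times> I (snd x)) \<le> emeasure torus_lebesgue (ball \<xi> r)"
    by (subst emeasure_torus_lebesgue) (auto intro!: emeasure_mono)
  then have *: "ennreal (r / 4) * ennreal (r / 4) \<le> emeasure torus_lebesgue (ball \<xi> r)"
    by (simp add: emeasure_lborel_rectangle I)
  have "ennreal (r / 4 * (r / 4)) \<le> ennreal (measure torus_lebesgue (ball \<xi> r))"
  proof -
    have "ennreal (r / 4 * (r / 4)) = ennreal (r / 4) * ennreal (r / 4)"
      using assms by (intro ennreal_mult) auto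
    with * show ?thesis
      by (simp only: finite_measure.emeasure_eq_measure[OF finite_measure_torus_lebesgue])
  qed
  then have "r / 4 * (r / 4) \<le> measure torus_lebesgue (ball \<xi> r)"
    by (simp add: ennreal_le_iff)
  then show ?thesis by (simp add: power2_eq_square)
qed

lemma free_disc_fixed_point:
  assumes f: "f \<in> Homeo0" "area_preserving f" and F: "is_lift F f" and p: "p \<in> lattice"
    and r: "0 < r" "r \<le> 1"
    and labels: "\<And>z. finite (labels F q p J x z)" "\<And>z. real (card (labels F q p J x z)) < r\<^sup>2 / 16 * real J"
    and free: "\<And>w. w \<in> ball x r \<Longrightarrow> (F ^^ q) w - p \<notin> ball x r"
  obtains w where "(F ^^ q) w = w + p"
proof -
  define G where "G w = (F ^^ q) w + - p" for w
  have eq: "equivariant F" and "\<exists>R. secant_log (conj_complex F) R"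
    using lift_of_Homeo0[OF f(1) F] by auto
  then obtain R where "secant_log (conj_complex F) R" by blast
  then obtain R' where "secant_log (conj_complex F ^^ q) R'" by (rule secant_log_funpow)
  then have "secant_log (conj_complex (F ^^ q)) R'" by (simp only: conj_complex_funpow)
  then have "secant_log (\<lambda>c. conj_complex (F ^^ q) c + Complex (- fst p) (- snd p)) R'"
    by (rule secant_log_translate)
  moreover have "conj_complex G = (\<lambda>c. conj_complex (F ^^ q) c + Complex (- fst p) (- snd p))"
    by (auto simp: conj_complex_def Let_def G_def complex_eq_iff)
  ultimately have sl: "secant_log (conj_complex G) R'" by simp
  have eq': "equivariant (F ^^ q)" using equivariant_funpow[OF eq] by (simp add: equivariant_def)
  then have eqG: "equivariant G" by (simp add: equivariant_def G_def algebra_simps)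
  have Gn: "(G ^^ i) z = (F ^^ (q * i)) z - real i *\<^sub>R p" for i z
    using funpow_translate[OF eq' lattice_closed_under(2)[OF p], of i z]
    by (simp add: G_def[abs_def] funpow_mult)
  have projG: "proj ((G ^^ i) z) = ((f ^^ q) ^^ i) (proj z)" for i z
  proof -
    have "proj ((G ^^ i) z) = proj ((F ^^ (q * i)) z)"
      using lattice_scale[OF p, of i] by (simp add: Gn proj_eq_iff lattice_closed_under)
    then show ?thesis by (simp add: is_lift_funpow_proj[OF F] funpow_mult)
  qed
  define B where "B = ball (proj x) r"
  interpret finite_measure torus_lebesgue by (rule finite_measure_torus_lebesgue)
  obtain y where y: "real J * measure torus_lebesgue B \<le> real (card {i. i < J \<and> ((f ^^ q) ^^ i) y \<in> B})"
  proof (rule measure_preserving_many_visits[of "f ^^ q" B J])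
    show "f ^^ q \<in> measurable torus_lebesgue torus_lebesgue" "distr torus_lebesgue torus_lebesgue (f ^^ q) = torus_lebesgue"
      using measure_preserving_funpow[of f torus_lebesgue] f(2) by (auto simp: area_preserving_def)
    show "measure torus_lebesgue (space torus_lebesgue) = 1"
      by (simp add: measure_def emeasure_torus_lebesgue_UNIV)
  qed (use that in \<open>auto simp: B_def\<close>)
  obtain z where z: "proj z = y" by (rule proj_surj)
  define I where "I = {i. i < J \<and> ((f ^^ q) ^^ i) y \<in> B}"
  have "\<exists>v\<in>lattice. norm ((G ^^ i) z - x - v) < r" if "i \<in> I" for i
    using that unfolding I_def B_def z[symmetric] by (simp add: mem_torus_ball flip: projG del: mem_ball)
  then obtain v where v: "\<And>i. i \<in> I \<Longrightarrow> v i \<in> lattice" "\<And>i. i \<in> I \<Longrightarrow> norm ((G ^^ i) z - x - v i) < r"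
    by metis
  have "v ` I \<subseteq> labels F q p J x z"
  proof (intro image_subsetI)
    fix i assume i: "i \<in> I"
    have "norm ((F ^^ (q * i)) z - real i *\<^sub>R p - x - v i) < 1"
      using v(2)[OF i] r unfolding Gn by linarith
    then show "v i \<in> labels F q p J x z"
      using i v(1) by (auto simp: labels_def I_def)
  qed
  moreover have "real (card (labels F q p J x z)) < real (card I)"
  proof -
    have "r\<^sup>2 / 16 * real J \<le> measure torus_lebesgue B * real J"
      unfolding B_def by (intro mult_right_mono measure_torus_ball_ge r) auto
    then show ?thesis using labels(2)[of z] y by (simp add: I_def mult.commute)
  qed
  ultimately have "\<not> inj_on v I"
    using labels(1)[of z] card_inj_on_le by (metis not_le of_nat_le_iff)
  then obtain i j where ij: "i \<in> I" "j \<in> I" "i < j" "v i = v j"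
    by (metis inj_onI linorder_neqE_nat)
  \<comment> \<open>Both visits are to the same translate of the disc. Translating it back gives a
    return to the disc itself, since \<open>G\<close> commutes with lattice translations.\<close>
  define w where "w = (G ^^ i) z + - v i"
  have "(G ^^ (j - i)) w = (G ^^ (j - i)) ((G ^^ i) z) + - v i"
    unfolding w_def by (rule equivariant_funpow[OF eqG lattice_closed_under(2)[OF v(1)[OF ij(1)]]])
  also have "(G ^^ (j - i)) ((G ^^ i) z) = (G ^^ j) z"
    using ij(3) by (metis funpow_add comp_apply le_add_diff_inverse2 less_imp_le)
  finally have ret: "(G ^^ (j - i)) w = (G ^^ j) z - v j" using ij(4) by simp
  have "w \<in> ball x r" "(G ^^ (j - i)) w \<in> ball x r"
    using v(2)[OF ij(1)] v(2)[OF ij(2)] unfolding ret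
    by (auto simp: w_def dist_norm norm_minus_commute algebra_simps)
  moreover have "G w \<notin> ball x r" if "w \<in> ball x r" for w
    using free[OF that] by (simp only: G_def add_uminus_conv_diff not_False_eq_True)
  moreover have "1 \<le> j - i" using ij(3) by simp
  ultimately obtain w' where "G w' = w'"
    using plane_free_disc_fixed_point[OF sl] by metis
  then have "(F ^^ q) w' = w' + p" by (simp add: G_def algebra_simps)
  then show ?thesis using that by blast
qed

section \<open>Iterates of Hoelder maps, choice of the disc, and conclusion\<close>

text \<open>Iteration raises the constant to the power \<open>1 + a + ... + a^(n-1)\<close>, which
  is at most \<open>n\<close> as \<open>a \<le> 1\<close>; this is why the constant is first
  enlarged to be at least 1.\<close>

lemma holder_funpow:
  fixes f :: "'a::metric_space \<Rightarrow> 'a"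
  assumes "holder a f" "0 < a" "a \<le> 1"
  obtains C where "1 \<le> C" "\<And>n x y. dist ((f ^^ n) x) ((f ^^ n) y) \<le> C ^ n * dist x y powr (a ^ n)"
proof -
  obtain C0 where C0: "\<And>x y. dist (f x) (f y) \<le> C0 * dist x y powr a"
    using assms(1) by (auto simp: holder_def)
  define C where "C = max C0 1"
  have C: "1 \<le> C" "\<And>x y. dist (f x) (f y) \<le> C * dist x y powr a"
  proof -
    show "1 \<le> C" by (simp add: C_def)
    show "dist (f x) (f y) \<le> C * dist x y powr a" for x y
      by (rule order_trans[OF C0 mult_right_mono]) (auto simp: C_def)
  qed
  have "dist ((f ^^ n) x) ((f ^^ n) y) \<le> C ^ n * dist x y powr (a ^ n)" for n x y
  proof (induction n)
    case (Suc n)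
    have "dist ((f ^^ Suc n) x) ((f ^^ Suc n) y) \<le> C * dist ((f ^^ n) x) ((f ^^ n) y) powr a"
      using C(2) by simp
    also have "\<dots> \<le> C * (C ^ n * dist x y powr (a ^ n)) powr a"
      using C(1) Suc assms(2) by (intro mult_left_mono powr_mono2) auto
    also have "\<dots> = C * ((C ^ n) powr a * dist x y powr (a ^ n * a))"
      using C(1) by (simp add: powr_mult powr_powr)
    also have "\<dots> \<le> C * (C ^ n * dist x y powr (a ^ n * a))"
    proof -
      have "(C ^ n) powr a \<le> (C ^ n) powr 1" using C(1) assms(3) by (intro powr_mono) auto
      then show ?thesis using C(1) by (intro mult_left_mono mult_right_mono) auto
    qed
    finally show ?case by (simp add: mult.assoc mult.commute)
  qed simp
  with C(1) show ?thesis using that by blast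
qed

lemma dist_C0_le:
  assumes "\<And>x. dist (f x) (g x) \<le> e"
  shows "dist_C0 f g \<le> e"
  unfolding dist_C0_def by (rule cSUP_least) (use assms in auto)

lemma dist_C0_nonneg: "0 \<le> dist_C0 f g"
  unfolding dist_C0_def
  by (rule cSUP_upper2[of _ _ undefined]) (auto intro!: bdd_aboveI2 dist_torus_le_2)

text \<open>The orbit of such a point moves by exactly \<open>p\<close> every \<open>q\<close>
  steps, so its mean displacement is \<open>p / q\<close>, and this must be the only rotation
  vector.\<close>

lemma no_lattice_translated_point:
  assumes F: "equivariant F" "continuous_on UNIV F" "rotation_set F = {\<omega>}"
    and "1 \<le> q" "p \<in> lattice" "(F ^^ q) w = w + p"
  shows "real q *\<^sub>R \<omega> = p"
proof (rule ccontr)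
  assume "real q *\<^sub>R \<omega> \<noteq> p"
  define \<epsilon> where "\<epsilon> = norm (p - real q *\<^sub>R \<omega>) / (2 * real q)"
  have "0 < \<epsilon>" using \<open>real q *\<^sub>R \<omega> \<noteq> p\<close> \<open>1 \<le> q\<close> by (simp add: \<epsilon>_def)
  then obtain N where N: "\<And>n z. n \<ge> N \<Longrightarrow> norm ((F ^^ n) z - z - real n *\<^sub>R \<omega>) \<le> \<epsilon> * real n"
    using rotation_set_singleton_uniform[OF F] by metis
  define n where "n = Suc N"
  have "(F ^^ (q * n)) w = w + real n *\<^sub>R p" for n
  proof (induction n)
    case (Suc n)
    have "q * Suc n = q * n + q" by simp
    then have "(F ^^ (q * Suc n)) w = (F ^^ (q * n)) ((F ^^ q) w)"
      by (simp only: funpow_add o_apply)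
    then show ?case
      using equivariant_funpow[OF F(1) assms(5), of "q * n" w] Suc assms(6)
      by (simp add: algebra_simps)
  qed simp
  then have "(F ^^ (q * n)) w - w - real (q * n) *\<^sub>R \<omega> = real n *\<^sub>R (p - real q *\<^sub>R \<omega>)"
    by (simp add: algebra_simps)
  moreover have "N \<le> q * n" using mult_le_mono1[OF \<open>1 \<le> q\<close>, of n] by (simp add: n_def)
  ultimately have "real n * norm (p - real q *\<^sub>R \<omega>) \<le> \<epsilon> * real (q * n)"
    using N[of "q * n" w] by simp
  also have "\<dots> = real n * (norm (p - real q *\<^sub>R \<omega>) / 2)" using \<open>1 \<le> q\<close> by (simp add: \<epsilon>_def)
  finally have "norm (p - real q *\<^sub>R \<omega>) \<le> norm (p - real q *\<^sub>R \<omega>) / 2"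
    by (simp add: n_def)
  then show False using \<open>real q *\<^sub>R \<omega> \<noteq> p\<close> by simp
qed

text \<open>Every \<open>q\<close> at which the arithmetic quantity falls below \<open>- M\<close>
  is a time of closeness, and the lower limit supplies such \<open>q\<close> beyond any
  bound.\<close>

lemma few_labels_imp_frequently_close:
  fixes a :: real
  assumes a: "0 < a" "a \<le> 1" and f: "f \<in> Homeo0" "area_preserving f" "holder a f"
    and F: "is_lift F f" "rotation_set F = {\<omega>}" and few: "few_labels F \<omega>"
    and arith: "liminf (\<lambda>n. ereal (inverse (real n) * a ^ n * ln (torus_norm (real n *\<^sub>R \<omega>)))) = - \<infinity>"
    and \<epsilon>: "0 < \<epsilon>" "\<epsilon> \<le> 1"
  shows "\<exists>\<^sub>F n in sequentially. dist_C0 (f ^^ n) id \<le> \<epsilon>"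
proof -
  obtain C \<delta>0 where C: "0 < C" and \<delta>0: "0 < \<delta>0" and few':
    "\<And>q p. 1 \<le> q \<Longrightarrow> p \<in> lattice \<Longrightarrow> 0 < norm (real q *\<^sub>R \<omega> - p) \<Longrightarrow> norm (real q *\<^sub>R \<omega> - p) < \<delta>0 \<Longrightarrow>
     \<exists>J. \<forall>x z. finite (labels F q p J x z) \<and>
        real (card (labels F q p J x z)) < C * norm (real q *\<^sub>R \<omega> - p) * real J"
    using few unfolding few_labels_def by blast
  obtain H where H: "1 \<le> H" "\<And>n x y. dist ((f ^^ n) x) ((f ^^ n) y) \<le> H ^ n * dist x y powr (a ^ n)"
    using holder_funpow[OF f(3) a] by blast
  \<comment> \<open>\<open>B\<close> is made for the estimate \<open>- ln r \<le> B * s\<close> with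
    \<open>s = q / a^q\<close>. \<open>M\<close> adds up what
    \<open>C * \<delta> \<le> r\<^sup>2 / 16\<close> and \<open>\<delta> < \<delta>0\<close> require
    after taking logarithms; \<open>1 \<le> s\<close> lets it absorb the constant terms.\<close>
  define B where "B = \<bar>ln (\<epsilon> / 4)\<bar> + ln H"
  define M where "M = 2 * B + \<bar>ln C\<bar> + ln 16 + \<bar>ln \<delta>0\<bar> + 1"
  have "0 \<le> B" using H(1) by (simp add: B_def)
  then have "0 \<le> M" by (simp add: M_def)
  have close: "dist_C0 (f ^^ q) id \<le> \<epsilon>"
    if "inverse (real q) * a ^ q * ln (torus_norm (real q *\<^sub>R \<omega>)) < - M" for q
  proof -
    \<comment> \<open>At \<open>q = 0\<close> the quantity is 0, because
      \<open>inverse 0 = 0\<close>.\<close>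
    have "q \<noteq> 0" using that \<open>0 \<le> M\<close> by (cases "q = 0") auto
    then have q: "1 \<le> q" by simp
    obtain p where p: "p \<in> lattice" "torus_norm (real q *\<^sub>R \<omega>) = norm (real q *\<^sub>R \<omega> - p)"
      by (rule torus_norm_attained)
    define \<delta> where "\<delta> = norm (real q *\<^sub>R \<omega> - p)"
    have aq: "0 < a ^ q" "a ^ q \<le> 1" using a by (auto simp: power_le_one)
    define s where "s = real q / a ^ q"
    have s: "1 \<le> s"
    proof -
      have "a ^ q \<le> real q" using aq q by linarith
      then show ?thesis using aq by (simp add: s_def)
    qed
    have ln\<delta>: "ln \<delta> < - (M * s)"
      using that aq q by (simp add: p(2) s_def field_simps flip: \<delta>_def)
    \<comment> \<open>By convention \<open>ln 0 = 0\<close>, which is not below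
      \<open>- (M * s)\<close>.\<close>
    have "\<delta> \<noteq> 0" using ln\<delta> \<open>0 \<le> M\<close> s by (auto simp: mult_less_0_iff)
    then have "0 < \<delta>" by (simp add: \<delta>_def)
    have Ms: "2 * (B * s) + \<bar>ln C\<bar> + ln 16 + \<bar>ln \<delta>0\<bar> \<le> M * s"
    proof -
      have "1 * (\<bar>ln C\<bar> + ln 16 + \<bar>ln \<delta>0\<bar>) \<le> s * (\<bar>ln C\<bar> + ln 16 + \<bar>ln \<delta>0\<bar>)"
        using s by (intro mult_right_mono) auto
      then show ?thesis using s by (simp add: M_def algebra_simps)
    qed
    have Bs: "0 \<le> B * s" using \<open>0 \<le> B\<close> s by simp
    have ln16: "0 \<le> ln (16 :: real)" by simp
    have "ln \<delta> < ln \<delta>0" using ln\<delta> Ms Bs ln16 by linarith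
    then have "\<delta> < \<delta>0" using \<open>0 < \<delta>\<close> \<delta>0 by simp
    \<comment> \<open>With this choice \<open>H ^ q * r powr (a ^ q) = \<epsilon> / 4\<close>, so
      \<open>f ^^ q\<close> maps a disc of radius \<open>r\<close> to within
      \<open>\<epsilon> / 4\<close> of the image of its centre. As also
      \<open>r \<le> \<epsilon> / 4\<close>, the disc is free once its centre moves by more than
      \<epsilon>.\<close>
    define b where "b = \<epsilon> / (4 * H ^ q)"
    define r where "r = b powr (1 / a ^ q)"
    have Hq: "1 \<le> H ^ q" using H(1) by simp
    have b: "0 < b" "b \<le> \<epsilon> / 4"
    proof -
      show "0 < b" using \<epsilon> Hq by (simp add: b_def)
      have "\<epsilon> * 1 \<le> \<epsilon> * H ^ q" using \<epsilon> Hq by (intro mult_left_mono) auto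
      then show "b \<le> \<epsilon> / 4" using Hq by (simp add: b_def field_simps)
    qed
    have "0 < r" using b by (simp add: r_def)
    have "r \<le> b powr 1" unfolding r_def using b \<epsilon> aq by (intro powr_mono') auto
    then have r: "r \<le> \<epsilon> / 4" "r \<le> 1" using b \<epsilon> by auto
    have ra: "r powr (a ^ q) = b" using b aq a by (simp add: r_def powr_powr)
    have "ln b \<ge> - (real q * B)"
    proof -
      have "ln b = ln (\<epsilon> / 4) - real q * ln H"
        using \<epsilon> H(1) by (simp add: b_def ln_div ln_mult ln_realpow)
      moreover have "1 * \<bar>ln (\<epsilon> / 4)\<bar> \<le> real q * \<bar>ln (\<epsilon> / 4)\<bar>" using q by (intro mult_right_mono) auto
      ultimately show ?thesis unfolding B_def distrib_left by linarith
    qed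
    then have "- (real q * B) / a ^ q \<le> ln b / a ^ q" using aq by (intro divide_right_mono) auto
    then have lnr: "- (B * s) \<le> ln r" using b by (simp add: r_def ln_powr s_def mult.commute)
    have "ln (C * \<delta>) \<le> ln (r\<^sup>2 / 16)"
    proof -
      have "ln (C * \<delta>) = ln C + ln \<delta>" using C \<open>0 < \<delta>\<close> by (simp add: ln_mult)
      also have "\<dots> \<le> 2 * ln r - ln 16"
        using ln\<delta> Ms lnr by linarith
      also have "\<dots> = ln (r\<^sup>2 / 16)" using \<open>0 < r\<close> by (simp add: ln_div ln_realpow)
      finally show ?thesis .
    qed
    then have C\<delta>: "C * \<delta> \<le> r\<^sup>2 / 16" using C \<open>0 < \<delta>\<close> \<open>0 < r\<close> by simp
    obtain J where J: "\<And>x z. finite (labels F q p J x z)"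
      "\<And>x z. real (card (labels F q p J x z)) < C * \<delta> * real J"
      using few'[OF q p(1)] \<open>0 < \<delta>\<close> \<open>\<delta> < \<delta>0\<close> unfolding \<delta>_def by blast
    show ?thesis
    proof (rule ccontr)
      assume "\<not> dist_C0 (f ^^ q) id \<le> \<epsilon>"
      then obtain \<xi> where \<xi>: "\<epsilon> < dist ((f ^^ q) \<xi>) \<xi>"
        using dist_C0_le[of "f ^^ q" id \<epsilon>] by (auto simp: not_le[symmetric])
      obtain x where x: "proj x = \<xi>" by (rule proj_surj)
      have "\<exists>w. (F ^^ q) w = w + p"
      proof (rule free_disc_fixed_point[OF f(1,2) F(1) p(1) \<open>0 < r\<close> r(2) J(1)])
        show "real (card (labels F q p J x z)) < r\<^sup>2 / 16 * real J" for z
          using J(2)[of x z] mult_right_mono[OF C\<delta>, of "real J"] by simp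
        show "(F ^^ q) w - p \<notin> ball x r" if w: "w \<in> ball x r" for w
        proof
          assume "(F ^^ q) w - p \<in> ball x r"
          then have "dist (proj ((F ^^ q) w - p)) \<xi> < r"
            using dist_proj_le[of "(F ^^ q) w - p" x] x by (simp add: dist_commute)
          moreover have "proj ((F ^^ q) w - p) = (f ^^ q) (proj w)"
            using p(1) by (metis is_lift_funpow_proj[OF F(1)] proj_add_lattice diff_add_cancel)
          moreover have "dist ((f ^^ q) (proj w)) ((f ^^ q) \<xi>) \<le> \<epsilon> / 4"
          proof -
            have "dist (proj w) \<xi> \<le> r" using dist_proj_le[of w x] w x by (simp add: dist_commute)
            then have "H ^ q * dist (proj w) \<xi> powr (a ^ q) \<le> H ^ q * r powr (a ^ q)"
              using Hq aq by (intro mult_left_mono powr_mono2) auto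
            also have "\<dots> = \<epsilon> / 4" using H(1) by (simp add: ra b_def)
            finally show ?thesis using H(2)[of q "proj w" \<xi>] by linarith
          qed
          ultimately show False
            using \<xi> r(1) \<epsilon> dist_triangle2[of "(f ^^ q) \<xi>" \<xi> "(f ^^ q) (proj w)"]
            by (simp add: dist_commute)
        qed
      qed blast
      then obtain w where "(F ^^ q) w = w + p" by blast
      with no_lattice_translated_point[OF lift_of_Homeo0(1)[OF f(1) F(1)] is_lift_continuous[OF F(1)] F(2) q p(1)]
      show False using \<open>0 < \<delta>\<close> by (simp add: \<delta>_def)
    qed
  qed
  show ?thesis
  proof (rule ccontr)
    assume "\<not> ?thesis"
    then have "\<forall>\<^sub>F n in sequentially. \<not> dist_C0 (f ^^ n) id \<le> \<epsilon>" by (simp add: not_frequently)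
    then have "\<forall>\<^sub>F n in sequentially.
        ereal (- M) \<le> ereal (inverse (real n) * a ^ n * ln (torus_norm (real n *\<^sub>R \<omega>)))"
    proof eventually_elim
      case (elim n)
      then have "- M \<le> inverse (real n) * a ^ n * ln (torus_norm (real n *\<^sub>R \<omega>))"
        using close[of n] by (meson not_le)
      then show ?case by (simp only: ereal_less_eq)
    qed
    then have "ereal (- M) \<le> - \<infinity>" unfolding arith[symmetric] by (rule Liminf_bounded)
    then show False by simp
  qed
qed

theorem theorem1:
  fixes a :: real and f :: "torus \<Rightarrow> torus" and \<omega> :: "real \<times> real"
  assumes "0 < a" and "a \<le> 1"
    and "pseudo_rotation f" and "area_preserving f" and "holder a f"
    and "rotation_number f = proj \<omega>" and "irrational \<omega>"
    and "liminf (\<lambda>n. ereal (inverse (real n) * a ^ n * ln (torus_norm (real n *\<^sub>R \<omega>)))) = - \<infinity>"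
    and "bounded_mean_motion f \<or>
         semi_irrational \<omega> \<and>
           (\<exists>l\<ge>1. \<exists>v. character_vector \<omega> v \<and> bounded_deviation (f ^^ l) v)"
  shows "C0_rigid f"
proof -
  have f0: "f \<in> Homeo0" using assms(3) by (simp add: pseudo_rotation_def)
  obtain F where F: "is_lift F f" "rotation_set F = {\<omega>}"
    using pseudo_rotation_lift[OF assms(3,6)] by blast
  have eq: "equivariant F" by (rule lift_of_Homeo0(1)[OF f0 F(1)])
  have cF: "continuous_on UNIV F" by (rule is_lift_continuous[OF F(1)])
  have "few_labels F \<omega>"
    using assms(9)
  proof (elim disjE conjE exE)
    assume "bounded_mean_motion f"
    then obtain \<kappa> F1 where F1: "is_lift F1 f"
      and \<kappa>: "\<And>z n. norm ((F1 ^^ n) z - z - real n *\<^sub>R rotation_vector F1) \<le> \<kappa>"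
      by (auto simp: bounded_mean_motion_def)
    \<comment> \<open>Bounded mean motion is transferred to \<open>F\<close> one coordinate at a
      time, as the case \<open>l = 1\<close>.\<close>
    have F1': "is_lift F1 (f ^^ 1)" using F1 by simp
    have ex: "\<exists>K. \<forall>z n. \<bar>((F ^^ n) z - z - real n *\<^sub>R \<omega>) \<bullet> e\<bar> \<le> K" if "norm e = 1" for e
    proof -
      have "\<bar>((F1 ^^ n) z - z - real n *\<^sub>R rotation_vector F1) \<bullet> e\<bar> \<le> \<kappa>" for z n
        using Cauchy_Schwarz_ineq2[of "(F1 ^^ n) z - z - real n *\<^sub>R rotation_vector F1" e] \<kappa>[of n z] that by simp
      from bounded_deviation_rotation[OF eq cF F F1' _ this] show ?thesis by (metis order_refl)
    qed
    obtain K1 where K1: "\<And>z n. \<bar>((F ^^ n) z - z - real n *\<^sub>R \<omega>) \<bullet> (1, 0)\<bar> \<le> K1"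
      using ex[of "(1, 0)"] by (auto simp: norm_Pair)
    obtain K2 where K2: "\<And>z n. \<bar>((F ^^ n) z - z - real n *\<^sub>R \<omega>) \<bullet> (0, 1)\<bar> \<le> K2"
      using ex[of "(0, 1)"] by (auto simp: norm_Pair)
    show ?thesis
    proof (rule few_labels_bounded_mean_motion)
      fix z n
      define X where "X = (F ^^ n) z - z - real n *\<^sub>R \<omega>"
      have "norm X \<le> \<bar>X \<bullet> (1, 0)\<bar> + \<bar>X \<bullet> (0, 1)\<bar>"
        using norm_Pair_le[of "fst X" "snd X"] by (simp add: inner_prod_def)
      then show "norm ((F ^^ n) z - z - real n *\<^sub>R \<omega>) \<le> K1 + K2"
        using K1[of n z] K2[of n z] unfolding X_def by linarith
    qed
  next
    fix l v assume l: "1 \<le> l" and v: "character_vector \<omega> v" and bd: "bounded_deviation (f ^^ l) v"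
    obtain c d :: int where cd: "(c, d) \<noteq> (0, 0)" "of_int c * fst \<omega> + of_int d * snd \<omega> \<in> \<rat>"
      and v_eq: "v = (of_int d, - of_int c)"
      using v by (auto simp: character_vector_def)
    obtain \<kappa> F1 where F1: "is_lift F1 (f ^^ l)"
      and \<kappa>: "\<And>z n. \<bar>((F1 ^^ n) z - z - real n *\<^sub>R rotation_vector F1) \<bullet> perp v\<bar> \<le> \<kappa>"
      using bd by (auto simp: bounded_deviation_def)
    obtain K where K: "\<And>z n. \<bar>((F ^^ n) z - z - real n *\<^sub>R \<omega>) \<bullet> perp v\<bar> \<le> K"
      using bounded_deviation_rotation[OF eq cF F F1 l \<kappa>] by blast
    have "v \<noteq> 0" using cd(1) by (auto simp: v_eq zero_prod_def)
    \<comment> \<open>Deviation parallel to \<open>v\<close> is measured along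
      \<open>perp v\<close>, which has the direction of \<open>(c, d)\<close>, the integer vector
      whose inner product with \<omega> is rational.\<close>
    then have e: "(of_int c, of_int d) = norm v *\<^sub>R perp v"
      by (simp add: perp_def v_eq)
    show ?thesis
    proof (rule few_labels_bounded_deviation[OF eq cF F(2) cd])
      fix z n
      show "\<bar>((F ^^ n) z - z - real n *\<^sub>R \<omega>) \<bullet> (of_int c, of_int d)\<bar> \<le> norm v * K"
        unfolding e using K[of n z] by (simp add: abs_mult mult_left_mono)
    qed
  qed
  then have freq: "\<exists>\<^sub>F n in sequentially. dist_C0 (f ^^ n) id \<le> \<epsilon>" if "0 < \<epsilon>" "\<epsilon> \<le> 1" for \<epsilon>
    using few_labels_imp_frequently_close[OF assms(1,2) f0 assms(4,5) F _ assms(8)] that by blast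
  have "liminf (\<lambda>n. ereal (dist_C0 (f ^^ n) id)) \<le> 0"
  proof (rule ccontr)
    assume "\<not> ?thesis"
    then obtain e :: real where e: "0 < ereal e" "ereal e < liminf (\<lambda>n. ereal (dist_C0 (f ^^ n) id))"
      by (metis ereal_dense2 not_le zero_ereal_def)
    then have "\<forall>\<^sub>F n in sequentially. ereal e < ereal (dist_C0 (f ^^ n) id)" by (intro less_LiminfD)
    then have "\<forall>\<^sub>F n in sequentially. \<not> dist_C0 (f ^^ n) id \<le> min e 1"
      by eventually_elim auto
    then show False using freq[of "min e 1"] e(1) by (simp add: frequently_def)
  qed
  moreover have "0 \<le> liminf (\<lambda>n. ereal (dist_C0 (f ^^ n) id))"
    by (rule Liminf_bounded) (simp add: dist_C0_nonneg)
  ultimately show ?thesis by (simp add: C0_rigid_def)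
qed

end
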